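(* Define blocks on the alphabet $\{0,1\}$ recursively by $B_0=0$ and $$B_{n+1}=B_n^{\,2^{n+1}-1}\,1^{\,2^{n(n+1)/2}}\qquad (n\ge 0),$$ and let $u\in\{0,1\}^{\mathbb N}$ be the one-sided infinite sequence that has $B_n$ as initial block for every $n\ge 0$. Then the shift on the orbit closure of $u$, equipped with its unique nonatomic shift-invariant Borel probability measure, is measure-theoretically isomorphic to the dyadic odometer.
   Context: Here $B^k$ denotes the concatenation of $k$ copies of the block $B$, and $1^k$ the block consisting of $k$ symbols $1$. The orbit closure of $u$ is taken as the (two-sided) subshift consisting of all $x\in\{0,1\}^{\mathbb Z}$ such that every finite block of consecutive symbols of $x$ occurs in $u$, with the shift map $(Sx)_k=x_{k+1}$. The dyadic odometer (von Neumann–Kakutani adding machine) is the map $x\mapsto x+1$ on the group $\mathbb Z_2$ of $2$-adic integers with Haar probability measure; equivalently, the transformation of the unit interval built by cutting and stacking where at each stage the tower is cut into two equal subcolumns which are stacked without spacers. Measure-theoretic isomorphism is the usual notion (a measure-preserving bijection between full-measure invariant sets that intertwines the transformations). *)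

theory Defs
  imports "HOL-Probability.Probability"
begin

section \<open>The blocks and the subshift\<close>

primrec rank_block :: "nat \<Rightarrow> nat list" where
  "rank_block 0 = [0]"
| "rank_block (Suc n) =
     concat (replicate (2 ^ (n + 1) - 1) (rank_block n)) @ replicate (2 ^ (n * (n + 1) div 2)) 1"

definition has_initial_block :: "(nat \<Rightarrow> nat) \<Rightarrow> nat list \<Rightarrow> bool" where
  "has_initial_block u w \<longleftrightarrow> (\<forall>i<length w. u i = w ! i)"

definition shift :: "(int \<Rightarrow> nat) \<Rightarrow> (int \<Rightarrow> nat)" where
  "shift x = (\<lambda>k. x (k + 1))"

text \<open>The blocks of consecutive symbols of \<open>x\<close> are the words \<open>x i, \<dots>, x (i + n - 1)\<close>.\<close>
definition orbit_closure :: "(nat \<Rightarrow> nat) \<Rightarrow> (int \<Rightarrow> nat) set" where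
  "orbit_closure u =
     {x. (\<forall>k. x k \<in> {0, 1}) \<and> (\<forall>i n. \<exists>j. \<forall>t<n. x (i + int t) = u (j + t))}"

section \<open>Measure-preserving systems\<close>

definition invariant_prob :: "'a measure \<Rightarrow> ('a \<Rightarrow> 'a) \<Rightarrow> bool" where
  "invariant_prob M T \<longleftrightarrow> prob_space M \<and> T \<in> measurable M M \<and> distr M M T = M"

definition nonatomic :: "'a measure \<Rightarrow> bool" where
  "nonatomic M \<longleftrightarrow>
     (\<forall>A\<in>sets M. 0 < emeasure M A \<longrightarrow>
        (\<exists>B\<in>sets M. B \<subseteq> A \<and> 0 < emeasure M B \<and> emeasure M B < emeasure M A))"

text \<open>Nonatomic shift-invariant Borel probability measures on a subshift; the topology on
  \<open>int \<Rightarrow> nat\<close> is the product of the discrete topologies.\<close>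
definition nonatomic_invariant_measure :: "(int \<Rightarrow> nat) set \<Rightarrow> (int \<Rightarrow> nat) measure \<Rightarrow> bool" where
  "nonatomic_invariant_measure X \<mu> \<longleftrightarrow>
     sets \<mu> = sets (restrict_space borel X) \<and> invariant_prob \<mu> shift \<and> nonatomic \<mu>"

definition measure_isomorphic ::
    "'a measure \<Rightarrow> ('a \<Rightarrow> 'a) \<Rightarrow> 'b measure \<Rightarrow> ('b \<Rightarrow> 'b) \<Rightarrow> bool" where
  "measure_isomorphic M T N S \<longleftrightarrow>
     (\<exists>A\<in>sets M. \<exists>B\<in>sets N. \<exists>f.
        emeasure M (space M - A) = 0 \<and> emeasure N (space N - B) = 0 \<and>
        T -` A \<inter> space M = A \<and> S -` B \<inter> space N = B \<and>
        bij_betw f A B \<and>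
        f \<in> measurable (restrict_space M A) (restrict_space N B) \<and>
        the_inv_into A f \<in> measurable (restrict_space N B) (restrict_space M A) \<and>
        distr (restrict_space M A) (restrict_space N B) f = restrict_space N B \<and>
        (\<forall>x\<in>A. f (T x) = S (f x)))"

section \<open>The dyadic odometer\<close>

text \<open>The 2-adic integers as the inverse limit of the rings \<open>\<int> / 2\<^sup>n\<int>\<close>: the value \<open>x n\<close> is the
  residue of \<open>x\<close> modulo \<open>2 ^ n\<close>. The topology is inherited from the product of the discrete
  topologies.\<close>
definition Z2 :: "(nat \<Rightarrow> nat) set" where
  "Z2 = {x. \<forall>n. x n < 2 ^ n \<and> x (Suc n) mod 2 ^ n = x n}"

definition Z2_add :: "(nat \<Rightarrow> nat) \<Rightarrow> (nat \<Rightarrow> nat) \<Rightarrow> (nat \<Rightarrow> nat)" where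
  "Z2_add x y = (\<lambda>n. (x n + y n) mod 2 ^ n)"

definition Z2_one :: "nat \<Rightarrow> nat" where
  "Z2_one = (\<lambda>n. 1 mod 2 ^ n)"

definition odometer :: "(nat \<Rightarrow> nat) \<Rightarrow> (nat \<Rightarrow> nat)" where
  "odometer x = Z2_add x Z2_one"

definition is_Z2_haar :: "(nat \<Rightarrow> nat) measure \<Rightarrow> bool" where
  "is_Z2_haar \<nu> \<longleftrightarrow> sets \<nu> = sets (restrict_space borel Z2) \<and> (\<forall>a\<in>Z2. invariant_prob \<nu> (Z2_add a))"

text \<open>Well defined by \<open>ex1_Z2_haar\<close> below.\<close>
definition Z2_haar :: "(nat \<Rightarrow> nat) measure" where
  "Z2_haar = (THE \<nu>. is_Z2_haar \<nu>)"

section \<open>Well-definedness\<close>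

lemma length_rank_block: "length (rank_block n) = 2 ^ (n * (n + 1) div 2)"
proof (induction n)
  case (Suc n)
  have e: "Suc n * (Suc n + 1) div 2 = n * (n + 1) div 2 + (n + 1)"
  proof -
    have "Suc n * (Suc n + 1) = n * (n + 1) + (n + 1) * 2" by simp
    then show ?thesis by (metis div_mult_self1 mult.commute zero_neq_numeral add.commute)
  qed
  have "(2 ^ (n + 1) - 1) * 2 ^ (n * (n + 1) div 2) + 2 ^ (n * (n + 1) div 2)
      = (2::nat) ^ (n * (n + 1) div 2 + (n + 1))"
    by (simp add: power_add algebra_simps diff_mult_distrib)
  then show ?case using Suc e
    by (simp add: length_concat sum_list_replicate)
qed simp

lemma less_length_rank_block: "n < length (rank_block n)"
proof -
  have "n \<le> n * (n + 1) div 2" by (cases n) (auto simp: div_le_mono)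
  also have "\<dots> < 2 ^ (n * (n + 1) div 2)" by (rule less_exp)
  finally show ?thesis unfolding length_rank_block .
qed

lemma rank_block_prefix:
  assumes "m \<le> n" "i < length (rank_block m)"
  shows "rank_block n ! i = rank_block m ! i \<and> i < length (rank_block n)"
  using assms
proof (induction n rule: dec_induct)
  case (step n)
  obtain k where k: "2 ^ (n + 1) - 1 = Suc k"
    by (metis One_nat_def Suc_diff_1 Suc_pred add_gr_0 diff_is_0_eq less_numeral_extra(1) not_less
        one_less_numeral_iff one_less_power semiring_norm(76) zero_less_diff)
  have "rank_block (Suc n) = rank_block n @ concat (replicate k (rank_block n)) @
      replicate (2 ^ (n * (n + 1) div 2)) 1"
    by (simp add: k del: power_Suc) (use k in simp)
  then show ?case using step by (simp add: nth_append del: rank_block.simps)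
qed simp

lemma ex1_initial_blocks: "\<exists>!u. \<forall>n. has_initial_block u (rank_block n)"
proof (rule ex1I[of _ "\<lambda>i. rank_block i ! i"])
  show "\<forall>n. has_initial_block (\<lambda>i. rank_block i ! i) (rank_block n)"
    unfolding has_initial_block_def
    by (metis less_length_rank_block nle_le rank_block_prefix)
next
  fix u assume "\<forall>n. has_initial_block u (rank_block n)"
  then show "u = (\<lambda>i. rank_block i ! i)"
    using less_length_rank_block by (auto simp: has_initial_block_def)
qed

lemma Z2_mod:
  assumes "x \<in> Z2" "m \<le> n" shows "x n mod 2 ^ m = x m"
  using assms(2)
proof (induction n rule: dec_induct)
  case base
  then show ?case using assms by (simp add: Z2_def)
next
  case (step n)
  have "x (Suc n) mod 2 ^ m = x (Suc n) mod 2 ^ n mod 2 ^ m"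
    using step(1) by (simp add: mod_mod_cancel le_imp_power_dvd)
  then show ?case using step assms by (simp add: Z2_def)
qed

lemma Z2_of_nat: "(\<lambda>n. a mod 2 ^ n) \<in> Z2"
  by (simp add: Z2_def mod_mod_cancel)

lemma Z2_one_in: "Z2_one \<in> Z2"
  unfolding Z2_one_def by (rule Z2_of_nat)

lemma Z2_add_in:
  assumes "x \<in> Z2" "y \<in> Z2" shows "Z2_add x y \<in> Z2"
proof -
  have "(x (Suc n) + y (Suc n)) mod 2 ^ Suc n mod 2 ^ n = (x n + y n) mod 2 ^ n" for n
  proof -
    have "(x (Suc n) + y (Suc n)) mod 2 ^ Suc n mod 2 ^ n = (x (Suc n) + y (Suc n)) mod 2 ^ n"
      by (simp add: mod_mod_cancel)
    also have "\<dots> = (x (Suc n) mod 2 ^ n + y (Suc n) mod 2 ^ n) mod 2 ^ n"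
      by (simp add: mod_add_eq)
    finally show ?thesis using assms by (simp add: Z2_def)
  qed
  then show ?thesis by (simp add: Z2_def Z2_add_def del: power_Suc)
qed

lemma Z2_coord_measurable:
  assumes "sets \<nu> = sets (restrict_space borel Z2)"
  shows "(\<lambda>x. x n) \<in> measurable \<nu> (count_space UNIV)"
proof -
  have "(\<lambda>x::nat \<Rightarrow> nat. x n) \<in> borel_measurable borel"
    by (intro borel_measurable_continuous_onI continuous_on_product_coordinates)
  then have "(\<lambda>x::nat \<Rightarrow> nat. x n) \<in> measurable borel (count_space UNIV)"
    by (simp add: measurable_cong_sets[OF refl sets_borel_eq_count_space])
  then show ?thesis
    using measurable_cong_sets[OF assms refl] by (auto intro: measurable_restrict_space1)
qed

lemma Z2_measurableI:
  assumes \<nu>: "sets \<nu> = sets (restrict_space borel Z2)"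
    and f: "\<And>x. x \<in> space M \<Longrightarrow> f x \<in> Z2"
    and c: "\<And>n. (\<lambda>x. f x n) \<in> measurable M (count_space UNIV)"
  shows "f \<in> measurable M \<nu>"
proof -
  have "(\<lambda>x. f x n) \<in> borel_measurable M" for n
    using c[of n] by (simp add: measurable_cong_sets[OF refl sets_borel_eq_count_space])
  then have "f \<in> borel_measurable M" by (rule measurable_coordinatewise_then_product)
  then have "f \<in> measurable M (restrict_space borel Z2)"
    using f by (intro measurable_restrict_space2) auto
  then show ?thesis using measurable_cong_sets[OF refl \<nu>] by blast
qed

lemma Z2_space:
  assumes "sets \<nu> = sets (restrict_space borel Z2)" shows "space \<nu> = Z2"
  using sets_eq_imp_space_eq[OF assms] by (simp add: space_restrict_space)

lemma Z2_cylinder_sets: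
  assumes "sets \<nu> = sets (restrict_space borel Z2)" shows "{x\<in>Z2. x n \<in> A} \<in> sets \<nu>"
  using measurable_sets[OF Z2_coord_measurable[OF assms, of n], of A] Z2_space[OF assms]
  by (simp add: vimage_def Int_def conj_commute)

lemma Z2_measure_eqI:
  assumes \<mu>: "sets \<mu> = sets (restrict_space borel Z2)" "prob_space \<mu>"
    and \<nu>: "sets \<nu> = sets (restrict_space borel Z2)"
    and eq: "\<And>n a. a < 2 ^ n \<Longrightarrow> emeasure \<mu> {x\<in>Z2. x n = a} = emeasure \<nu> {x\<in>Z2. x n = a}"
  shows "\<mu> = \<nu>"
proof -
  interpret \<mu>: prob_space \<mu> by fact
  let ?B = "\<lambda>_::nat. borel :: nat measure"
  note sp = Z2_space[OF \<mu>(1)] Z2_space[OF \<nu>]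
  have idm: "(\<lambda>x. x) \<in> borel_measurable \<mu>" "(\<lambda>x. x) \<in> borel_measurable \<nu>"
    by (simp_all add: measurable_cong_sets[OF \<mu>(1) refl] measurable_cong_sets[OF \<nu> refl]
        measurable_restrict_space1)
  have eqA: "emeasure \<mu> {x\<in>Z2. x n \<in> A} = emeasure \<nu> {x\<in>Z2. x n \<in> A}" for n A
  proof -
    let ?A = "A \<inter> {..<2 ^ n}"
    have U: "{x\<in>Z2. x n \<in> A} = (\<Union>a\<in>?A. {x\<in>Z2. x n = a})"
      by (auto simp: Z2_def)
    have s: "{x\<in>Z2. x n = a} \<in> sets \<mu>" "{x\<in>Z2. x n = a} \<in> sets \<nu>" for a
      using Z2_cylinder_sets[OF \<mu>(1), of n "{a}"] Z2_cylinder_sets[OF \<nu>, of n "{a}"] by auto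
    have d: "disjoint_family_on (\<lambda>a. {x\<in>Z2. x n = a}) ?A"
      by (auto simp: disjoint_family_on_def)
    have "emeasure \<mu> {x\<in>Z2. x n \<in> A} = (\<Sum>a\<in>?A. emeasure \<mu> {x\<in>Z2. x n = a})"
      unfolding U by (rule sum_emeasure[symmetric]) (use s d in auto)
    also have "\<dots> = (\<Sum>a\<in>?A. emeasure \<nu> {x\<in>Z2. x n = a})"
      by (rule sum.cong) (auto intro: eq)
    also have "\<dots> = emeasure \<nu> {x\<in>Z2. x n \<in> A}"
      unfolding U by (rule sum_emeasure) (use s d in auto)
    finally show ?thesis .
  qed
  have sP: "sets (borel :: (nat \<Rightarrow> nat) measure) = sets (Pi\<^sub>M UNIV ?B)"
    by (rule sets_PiM_equal_borel[symmetric])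
  have "distr \<mu> borel (\<lambda>x. x) = distr \<nu> borel (\<lambda>x. x)"
  proof (rule measure_eqI_PiM_infinite[where I = UNIV and M = ?B])
    show "finite_measure (distr \<mu> borel (\<lambda>x. x))"
      using \<mu>.prob_space_distr[OF idm(1)] by (simp add: prob_space_def)
    fix A :: "nat \<Rightarrow> nat set" and J :: "nat set"
    assume J: "finite J" and A: "\<And>i. i \<in> J \<Longrightarrow> A i \<in> sets borel"
    let ?E = "prod_emb UNIV ?B J (Pi\<^sub>E J A)"
    have E: "?E = {x. \<forall>i\<in>J. x i \<in> A i}"
      by (auto simp: prod_emb_def PiE_iff restrict_def extensional_def)
    have Es: "?E \<in> sets borel"
      unfolding sP using J A by (intro sets_PiM_I) auto
    obtain N where N: "\<And>i. i \<in> J \<Longrightarrow> i \<le> N"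
      using J unfolding finite_nat_set_iff_bounded_le by auto
    have E': "?E \<inter> Z2 = {x\<in>Z2. x N \<in> {a. \<forall>i\<in>J. a mod 2 ^ i \<in> A i}}"
    proof -
      have "x i = x N mod 2 ^ i" if "x \<in> Z2" "i \<in> J" for x i
        using Z2_mod[OF that(1) N[OF that(2)]] by simp
      then show ?thesis unfolding E by (auto 0 3)
    qed
    show "emeasure (distr \<mu> borel (\<lambda>x. x)) ?E = emeasure (distr \<nu> borel (\<lambda>x. x)) ?E"
      using idm Es eqA[of N "{a. \<forall>i\<in>J. a mod 2 ^ i \<in> A i}"] by (simp add: emeasure_distr sp E')
  qed (simp_all add: sP)
  then have *: "emeasure \<mu> (A \<inter> Z2) = emeasure \<nu> (A \<inter> Z2)" if "A \<in> sets borel" for A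
    using arg_cong[of _ _ "\<lambda>M. emeasure M A"] emeasure_distr[OF idm(1) that]
      emeasure_distr[OF idm(2) that] by (simp add: sp)
  show ?thesis
  proof (rule measure_eqI)
    show "sets \<mu> = sets \<nu>" using \<mu> \<nu> by simp
    fix A assume "A \<in> sets \<mu>"
    then obtain A' where "A' \<in> sets borel" "A = A' \<inter> Z2"
      using \<mu>(1) by (auto simp: sets_restrict_space)
    then show "emeasure \<mu> A = emeasure \<nu> A" using * by simp
  qed
qed

lemma Z2_translate_cylinder:
  assumes "a \<in> Z2" "c < 2 ^ n"
  shows "{x\<in>Z2. Z2_add a x n = c} = {x\<in>Z2. x n = (c + (2 ^ n - a n)) mod 2 ^ n}"
proof -
  have "(a n + v) mod 2 ^ n = c \<longleftrightarrow> v = (c + (2 ^ n - a n)) mod 2 ^ n" if v: "v < 2 ^ n" for v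
  proof -
    have a: "a n < 2 ^ n" using assms by (simp add: Z2_def)
    show ?thesis
      using a v assms(2) by (auto simp: mod_if)
  qed
  then show ?thesis by (auto simp: Z2_add_def Z2_def)
qed

lemma Z2_add_measurable:
  assumes "sets \<nu> = sets (restrict_space borel Z2)" "a \<in> Z2"
  shows "Z2_add a \<in> measurable \<nu> \<nu>"
proof (rule Z2_measurableI[OF assms(1)])
  show "Z2_add a x \<in> Z2" if "x \<in> space \<nu>" for x
    using that assms Z2_space Z2_add_in by blast
  show "(\<lambda>x. Z2_add a x n) \<in> measurable \<nu> (count_space UNIV)" for n
    unfolding Z2_add_def
    by (rule measurable_compose[OF Z2_coord_measurable[OF assms(1)]]) simp
qed

lemma Z2_haar_cylinder:
  assumes "is_Z2_haar \<nu>" "a < 2 ^ n"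
  shows "emeasure \<nu> {x\<in>Z2. x n = a} = 1 / 2 ^ n"
proof -
  have \<nu>: "sets \<nu> = sets (restrict_space borel Z2)" "prob_space \<nu>"
    using assms(1) Z2_one_in by (auto simp: is_Z2_haar_def invariant_prob_def)
  interpret \<nu>: prob_space \<nu> by fact
  note sp = Z2_space[OF \<nu>(1)]
  have s: "{x\<in>Z2. x n = c} \<in> sets \<nu>" for c
    using Z2_cylinder_sets[OF \<nu>(1), of n "{c}"] by auto
  have *: "emeasure \<nu> {x\<in>Z2. x n = c} = emeasure \<nu> {x\<in>Z2. x n = 0}" if c: "c < 2 ^ n" for c
  proof -
    let ?t = "\<lambda>m. c mod 2 ^ m"
    have t: "?t \<in> Z2" by (rule Z2_of_nat)
    have "emeasure \<nu> {x\<in>Z2. x n = c} = emeasure (distr \<nu> \<nu> (Z2_add ?t)) {x\<in>Z2. x n = c}"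
      using assms(1) t by (simp add: is_Z2_haar_def invariant_prob_def)
    also have "\<dots> = emeasure \<nu> (Z2_add ?t -` {x\<in>Z2. x n = c} \<inter> space \<nu>)"
      by (rule emeasure_distr[OF Z2_add_measurable[OF \<nu>(1) t] s])
    also have "Z2_add ?t -` {x\<in>Z2. x n = c} \<inter> space \<nu> = {x\<in>Z2. Z2_add ?t x n = c}"
      using t Z2_add_in by (auto simp: sp)
    also have "\<dots> = {x\<in>Z2. x n = 0}"
      unfolding Z2_translate_cylinder[OF t c] using c by simp
    finally show ?thesis .
  qed
  have "1 = emeasure \<nu> Z2" using \<nu>.emeasure_space_1 sp by simp
  also have "Z2 = (\<Union>c\<in>{..<2 ^ n}. {x\<in>Z2. x n = c})" by (auto simp: Z2_def)
  also have "emeasure \<nu> \<dots> = (\<Sum>c<2 ^ n. emeasure \<nu> {x\<in>Z2. x n = c})"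
    by (rule sum_emeasure[symmetric]) (use s in \<open>auto simp: disjoint_family_on_def\<close>)
  also have "\<dots> = (\<Sum>c<(2::nat) ^ n. emeasure \<nu> {x\<in>Z2. x n = 0})"
    by (rule sum.cong) (auto intro: *)
  also have "\<dots> = 2 ^ n * emeasure \<nu> {x\<in>Z2. x n = 0}" by simp
  finally have "1 = 2 ^ n * emeasure \<nu> {x\<in>Z2. x n = a}" using *[OF assms(2)] by simp
  then have "1 / 2 ^ n = emeasure \<nu> {x\<in>Z2. x n = a} * 2 ^ n / 2 ^ n"
    by (simp add: mult.commute)
  also have "\<dots> = emeasure \<nu> {x\<in>Z2. x n = a}"
    by (rule ennreal_mult_divide_eq) (simp_all add: power_eq_top_ennreal)
  finally show ?thesis ..
qed

lemma Z2_haarI: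
  assumes \<nu>: "sets \<nu> = sets (restrict_space borel Z2)" "prob_space \<nu>"
    and c: "\<And>n a. a < 2 ^ n \<Longrightarrow> emeasure \<nu> {x\<in>Z2. x n = a} = 1 / 2 ^ n"
  shows "is_Z2_haar \<nu>"
proof -
  interpret \<nu>: prob_space \<nu> by fact
  note sp = Z2_space[OF \<nu>(1)]
  have "distr \<nu> \<nu> (Z2_add a) = \<nu>" if a: "a \<in> Z2" for a
  proof (rule Z2_measure_eqI)
    note m = Z2_add_measurable[OF \<nu>(1) a]
    show "prob_space (distr \<nu> \<nu> (Z2_add a))" by (rule \<nu>.prob_space_distr[OF m])
    fix n c :: nat assume lt: "c < 2 ^ n"
    have s: "{x\<in>Z2. x n = c} \<in> sets \<nu>"
      using Z2_cylinder_sets[OF \<nu>(1), of n "{c}"] by auto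
    have "Z2_add a -` {x\<in>Z2. x n = c} \<inter> space \<nu> = {x\<in>Z2. Z2_add a x n = c}"
      using a Z2_add_in by (auto simp: sp)
    then have "emeasure (distr \<nu> \<nu> (Z2_add a)) {x\<in>Z2. x n = c} = 1 / 2 ^ n"
      by (simp add: emeasure_distr[OF m s] Z2_translate_cylinder[OF a lt] c)
    then show "emeasure (distr \<nu> \<nu> (Z2_add a)) {x\<in>Z2. x n = c} = emeasure \<nu> {x\<in>Z2. x n = c}"
      using c lt by simp
  qed (use \<nu> in simp_all)
  then show ?thesis
    using \<nu> Z2_add_measurable by (simp add: is_Z2_haar_def invariant_prob_def)
qed

lemma ex_Z2_haar: "\<exists>\<nu>. is_Z2_haar \<nu>"
proof -
  define coin where "coin = measure_pmf (bernoulli_pmf (1 / 2))"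
  define P where "P = Pi\<^sub>M (UNIV :: nat set) (\<lambda>_. coin)"
  define f :: "(nat \<Rightarrow> bool) \<Rightarrow> nat \<Rightarrow> nat"
    where "f w n = horner_sum of_bool 2 (map w [0..<n])" for w n
  interpret P: product_prob_space "\<lambda>_::nat. coin" UNIV
    unfolding coin_def by unfold_locales
  have spP: "space P = UNIV" by (simp add: P_def space_PiM coin_def)
  have bit_f: "bit (f w n) i \<longleftrightarrow> i < n \<and> w i" for w n i
    by (auto simp: f_def bit_horner_sum_bit_iff)
  have f: "f w \<in> Z2" for w
  proof -
    have "take_bit n (f w n) = f w n" for n
      by (rule bit_eqI) (auto simp: bit_take_bit_iff bit_f)
    then have "f w n < 2 ^ n" for n by (metis take_bit_nat_less_exp)
    moreover have "take_bit n (f w (Suc n)) = f w n" for n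
      by (rule bit_eqI) (auto simp: bit_take_bit_iff bit_f)
    ultimately show ?thesis by (simp add: Z2_def take_bit_eq_mod)
  qed
  have cyl: "f w n = a \<longleftrightarrow> (\<forall>i<n. w i = bit a i)" if a: "a < 2 ^ n" for w n a
  proof -
    have "bit a i \<longleftrightarrow> i < n \<and> bit a i" for i
      using a by (metis bit_take_bit_iff take_bit_nat_eq_self)
    then show ?thesis unfolding bit_eq_iff using bit_f by (metis possible_bit_nat)
  qed
  have comp: "(\<lambda>w. w i) \<in> measurable P (count_space UNIV)" for i
    unfolding P_def
    using measurable_component_singleton[of i UNIV "\<lambda>_. coin"]
    by (simp add: coin_def measurable_cong_sets)
  have fm: "f \<in> measurable P (restrict_space borel Z2)"
  proof (rule Z2_measurableI[OF refl f])
    fix n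
    show "(\<lambda>w. f w n) \<in> measurable P (count_space UNIV)"
    proof (induction n)
      case (Suc n)
      have e: "f w (Suc n) = f w n + 2 ^ n * of_bool (w n)" for w
        by (simp add: f_def horner_sum_append)
      show ?case unfolding e using Suc comp[of n] by measurable
    qed (simp add: f_def)
  qed
  let ?\<nu> = "distr P (restrict_space borel Z2) f"
  have "is_Z2_haar ?\<nu>"
  proof (rule Z2_haarI)
    show "prob_space ?\<nu>"
      using P.prob_space_distr fm unfolding P_def by blast
    fix n a :: nat assume a: "a < 2 ^ n"
    have "{x\<in>Z2. x n = a} \<in> sets (restrict_space borel Z2)"
      using Z2_cylinder_sets[OF refl, of n "{a}"] by auto
    then have "emeasure ?\<nu> {x\<in>Z2. x n = a} = emeasure P {w\<in>space P. \<forall>i\<in>{..<n}. w i \<in> {bit a i}}"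
      using fm f cyl[OF a] by (simp add: emeasure_distr spP vimage_def Ball_def)
    also have "\<dots> = (\<Prod>i<n. emeasure coin {bit a i})"
      unfolding P_def by (rule P.emeasure_PiM_Collect) (auto simp: coin_def)
    also have "\<dots> = (\<Prod>i<n. ennreal (1 / 2))"
      by (intro prod.cong refl) (simp add: coin_def emeasure_pmf_single pmf_bernoulli_half)
    also have "\<dots> = ennreal ((1 / 2) ^ n)" by (simp add: ennreal_power del: ennreal_half)
    also have "\<dots> = 1 / 2 ^ n"
      by (simp add: divide_ennreal[symmetric] ennreal_power[symmetric] power_one_over)
    finally show "emeasure ?\<nu> {x\<in>Z2. x n = a} = 1 / 2 ^ n" .
  qed simp
  then show ?thesis ..
qed

lemma ex1_Z2_haar: "\<exists>!\<nu>. is_Z2_haar \<nu>"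
proof (rule ex_ex1I[OF ex_Z2_haar])
  fix \<mu> \<nu> assume *: "is_Z2_haar \<mu>" "is_Z2_haar \<nu>"
  show "\<mu> = \<nu>"
    by (rule Z2_measure_eqI)
      (use * Z2_one_in Z2_haar_cylinder in \<open>auto simp: is_Z2_haar_def invariant_prob_def\<close>)
qed

lemma is_Z2_haar_Z2_haar: "is_Z2_haar Z2_haar"
  unfolding Z2_haar_def by (rule theI'[OF ex1_Z2_haar])

end

theory Submission
  imports Defs
begin

text \<open>Write \<open>j\<close> in mixed radix with place values \<open>h\<^sub>m = |B\<^sub>m| = 2^(m(m+1)/2)\<close>, so that the
  \<open>m\<close>-th digit ranges over \<open>{0..<2^(m+1)}\<close>. Then \<open>u j = 1\<close> iff some digit of \<open>j\<close> is maximal. The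
  same rule applied to \<open>z + k\<close> codes a 2-adic integer \<open>z\<close> as a point of the orbit closure and
  intertwines the odometer with the shift. The residues of \<open>z\<close> can be read off its coding as
  soon as this has a zero, and every point of the orbit closure with a zero is a coding. The only
  point without a zero is the constant sequence \<open>1\<close>, which a nonatomic measure ignores; on the
  odometer side, Borel--Cantelli shows that almost every \<open>z\<close> has only finitely many maximal
  digits, and translating \<open>z\<close> to clear its low digits gives a zero of its coding. Uniqueness of
  the measure is then unique ergodicity of the odometer.\<close>

section \<open>Digits and blocks\<close>

definition tri :: "nat \<Rightarrow> nat" where
  "tri n = n * (n + 1) div 2"

lemma tri_Suc: "tri (Suc n) = tri n + Suc n"
  by (simp add: tri_def)

lemma tri_mono: "m \<le> n \<Longrightarrow> tri m \<le> tri n"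
  unfolding tri_def by (intro div_le_mono mult_le_mono) auto

lemma le_tri: "n \<le> tri n"
  by (induction n) (auto simp: tri_Suc)

text \<open>Every integer has a mixed-radix expansion whose \<open>m\<close>-th digit has place value
  \<open>2 ^ tri m = length (rank_block m)\<close> and ranges over \<open>{0..<2 ^ Suc m}\<close>.\<close>

definition max_digit :: "nat \<Rightarrow> int \<Rightarrow> bool" where
  "max_digit m a \<longleftrightarrow> a div 2 ^ tri m mod 2 ^ Suc m = 2 ^ Suc m - 1"

text \<open>The \<open>m\<close>-th digit consists of the bits from \<open>tri m\<close> to
  \<open>tri (Suc m) - 1\<close>, so only the residue modulo \<open>2 ^ tri (Suc m)\<close>
  matters.\<close>

lemma max_digit_cong:
  assumes "a mod 2 ^ tri (Suc m) = b mod 2 ^ tri (Suc m)"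
  shows "max_digit m a \<longleftrightarrow> max_digit m b"
proof -
  have "c div 2 ^ tri m mod 2 ^ Suc m = c mod 2 ^ tri (Suc m) div 2 ^ tri m" for c :: int
    using take_bit_drop_bit[of "Suc m" "tri m" c]
    by (simp add: take_bit_eq_mod drop_bit_eq_div tri_Suc add.commute del: power_Suc)
  then show ?thesis unfolding max_digit_def using assms by metis
qed

text \<open>The quotient by \<open>2 ^ tri n\<close> is the index of the block of rank
  \<open>n\<close> around the position. All digits from the \<open>n\<close>-th on are computed from
  it.\<close>

lemma max_digit_block:
  assumes "a div 2 ^ tri n = b div 2 ^ tri n" "n \<le> m"
  shows "max_digit m a \<longleftrightarrow> max_digit m b"
proof -
  have "c div 2 ^ tri m = c div 2 ^ tri n div 2 ^ (tri m - tri n)" for c :: int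
    by (simp add: zdiv_zmult2_eq[symmetric] power_add[symmetric] tri_mono[OF assms(2)])
  then show ?thesis unfolding max_digit_def using assms by metis
qed

lemma not_max_digit_small:
  assumes "0 \<le> a" "a < 2 ^ tri m"
  shows "\<not> max_digit m a"
proof -
  have "(1::int) < 2 ^ Suc m" by (rule one_less_power) auto
  then show ?thesis using assms unfolding max_digit_def by simp
qed

lemma Z2_mod_int:
  assumes "z \<in> Z2" "m \<le> n" shows "int (z n) mod 2 ^ m = int (z m)"
  using Z2_mod[OF assms] by (metis of_nat_mod of_nat_numeral of_nat_power)

lemma Z2_add_mod_int:
  assumes "z \<in> Z2" "m \<le> n" shows "(int (z n) + k) mod 2 ^ m = (int (z m) + k) mod 2 ^ m"
  using Z2_mod_int[OF assms] by (metis mod_add_left_eq)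

lemma max_digit_Z2:
  assumes "z \<in> Z2" "tri (Suc m) \<le> n"
  shows "max_digit m (int (z n) + k) \<longleftrightarrow> max_digit m (int (z (tri (Suc m))) + k)"
  by (intro max_digit_cong Z2_add_mod_int assms)

text \<open>Some digit of the 2-adic integer \<open>z + k\<close> is maximal; its \<open>m\<close>-th digit is determined by the
  residue \<open>z (tri (Suc m))\<close>.\<close>

definition hit :: "(nat \<Rightarrow> nat) \<Rightarrow> int \<Rightarrow> bool" where
  "hit z k \<longleftrightarrow> (\<exists>m. max_digit m (int (z (tri (Suc m))) + k))"

definition coding :: "(nat \<Rightarrow> nat) \<Rightarrow> int \<Rightarrow> nat" where
  "coding z k = of_bool (hit z k)"

lemma hit_nat: "hit (\<lambda>n. a mod 2 ^ n) k \<longleftrightarrow> (\<exists>m. max_digit m (int a + k))"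
proof -
  have "max_digit m (int (a mod 2 ^ tri (Suc m)) + k) \<longleftrightarrow> max_digit m (int a + k)" for m
    by (rule max_digit_cong) (simp add: of_nat_mod mod_add_left_eq)
  then show ?thesis by (simp add: hit_def)
qed

lemma nth_concat_replicate:
  "i < n * length xs \<Longrightarrow> concat (replicate n xs) ! i = xs ! (i mod length xs)"
proof (induction n arbitrary: i)
  case (Suc n)
  then show ?case
    by (cases "i < length xs") (auto simp: nth_append mod_if[of i])
qed simp

text \<open>The run of ones ending \<open>rank_block (Suc n)\<close> is as long as
  \<open>rank_block n\<close>, so it takes the place of one more copy. The \<open>n\<close>-th digit
  numbers the copies, its maximal value marks the run, and the lower digits give the place inside a
  copy.\<close>

lemma nth_rank_block:
  "i < 2 ^ tri n \<Longrightarrow> rank_block n ! i = of_bool (\<exists>m<n. max_digit m (int i))"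
proof (induction n arbitrary: i)
  case 0
  then show ?case by (simp add: tri_def)
next
  case (Suc n)
  let ?h = "2 ^ tri n :: nat" and ?q = "2 ^ Suc n :: nat"
  have len: "length (rank_block n) = ?h" by (simp add: length_rank_block tri_def)
  have i: "i < ?q * ?h" using Suc.prems by (simp add: tri_Suc power_add mult_ac)
  have blk: "rank_block (Suc n) = concat (replicate (?q - 1) (rank_block n)) @ replicate ?h 1"
    by (simp only: rank_block.simps tri_def flip: Suc_eq_plus1)
  have lc: "length (concat (replicate (?q - 1) (rank_block n))) = (?q - 1) * ?h"
    by (simp add: length_concat sum_list_replicate len del: power_Suc)
  have d: "i div ?h < ?q" using i by (simp add: less_mult_imp_div_less del: power_Suc)
  have dn: "max_digit n (int i) \<longleftrightarrow> i div ?h = ?q - 1"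
  proof -
    have "int i div 2 ^ tri n mod 2 ^ Suc n = int (i div ?h mod ?q)" by (simp add: zdiv_int zmod_int)
    also have "\<dots> = int (i div ?h)" using d by simp
    finally have "max_digit n (int i) \<longleftrightarrow> int (i div ?h) = int ?q - 1"
      unfolding max_digit_def by simp
    also have "\<dots> \<longleftrightarrow> i div ?h = ?q - 1"
    proof -
      have "1 \<le> ?q" by (rule one_le_power) simp
      then show ?thesis by linarith
    qed
    finally show ?thesis .
  qed
  show ?case
  proof (cases "i < (?q - 1) * ?h")
    case True
    have "rank_block (Suc n) ! i = rank_block n ! (i mod ?h)"
      using True nth_concat_replicate[of i "?q - 1" "rank_block n"] lc
      by (simp add: nth_append len blk del: power_Suc rank_block.simps)
    also have "\<dots> = of_bool (\<exists>m<n. max_digit m (int (i mod ?h)))"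
      by (rule Suc.IH) simp
    also have "(\<exists>m<n. max_digit m (int (i mod ?h))) \<longleftrightarrow> (\<exists>m<n. max_digit m (int i))"
    proof -
      have "max_digit m (int (i mod ?h)) \<longleftrightarrow> max_digit m (int i)" if "m < n" for m
        using that tri_mono[of "Suc m" n]
        by (intro max_digit_cong) (simp add: of_nat_mod mod_mod_cancel le_imp_power_dvd)
      then show ?thesis by auto
    qed
    also have "\<dots> \<longleftrightarrow> (\<exists>m<Suc n. max_digit m (int i))"
    proof -
      have "i div ?h < ?q - 1" using True by (simp add: less_mult_imp_div_less del: power_Suc)
      then have "\<not> max_digit n (int i)" unfolding dn by simp
      then show ?thesis by (auto simp: less_Suc_eq)
    qed
    finally show ?thesis .
  next
    case False
    then have "?q - 1 \<le> i div ?h" by (simp add: less_eq_div_iff_mult_less_eq del: power_Suc)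
    then have "max_digit n (int i)" using d unfolding dn by linarith
    moreover have "i - (?q - 1) * ?h < ?h"
      using i False by (simp add: algebra_simps diff_mult_distrib del: power_Suc)
    ultimately show ?thesis
      using False lc by (auto simp: nth_append blk simp del: power_Suc rank_block.simps)
  qed
qed

text \<open>As \<open>j < 2 ^ tri j\<close>, the block of rank \<open>j\<close> covers position
  \<open>j\<close>, and the digits of \<open>j\<close> from the \<open>j\<close>-th on
  vanish.\<close>

lemma initial_blocks_eq_coding:
  assumes "\<forall>n. has_initial_block u (rank_block n)"
  shows "u j = of_bool (\<exists>m. max_digit m (int j))"
proof -
  have j: "j < 2 ^ tri j" using less_length_rank_block[of j] by (simp add: length_rank_block tri_def)
  have "u j = rank_block j ! j"
    using assms less_length_rank_block by (simp add: has_initial_block_def)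
  also have "\<dots> = of_bool (\<exists>m<j. max_digit m (int j))" by (rule nth_rank_block[OF j])
  also have "(\<exists>m<j. max_digit m (int j)) \<longleftrightarrow> (\<exists>m. max_digit m (int j))"
  proof -
    have "\<not> max_digit m (int j)" if "j \<le> m" for m
    proof (rule not_max_digit_small)
      have "int j < 2 ^ tri j" using j by (metis of_nat_less_iff of_nat_numeral of_nat_power)
      also have "(2::int) ^ tri j \<le> 2 ^ tri m" by (simp add: tri_mono that)
      finally show "int j < 2 ^ tri m" .
    qed simp
    then show ?thesis using not_le by blast
  qed
  finally show ?thesis .
qed

section \<open>Recognizability\<close>

lemma div_add_one:
  fixes q :: int
  assumes "0 < q" "v mod q \<noteq> q - 1"
  shows "(v + 1) div q = v div q"
proof (rule int_div_pos_eq)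
  show "v + 1 = q * (v div q) + (v mod q + 1)" by simp
  show "0 \<le> v mod q + 1" "v mod q + 1 < q"
    using assms pos_mod_bound[of q v] pos_mod_sign[of q v] by linarith+
qed

lemma power_tri_Suc: "(2::int) ^ tri (Suc n) = 2 ^ tri n * 2 ^ Suc n"
  unfolding tri_Suc by (rule power_add)

lemma Z2_less_int: "z \<in> Z2 \<Longrightarrow> int (z n) < 2 ^ n"
proof -
  assume "z \<in> Z2"
  then have "int (z n) < int (2 ^ n)" unfolding Z2_def of_nat_less_iff by blast
  then show ?thesis by simp
qed

text \<open>The hypothesis \<open>eq\<close> says that positions \<open>k\<close> and \<open>l\<close> lie in the same block of rank \<open>n\<close>.\<close>

lemma div_eq_Z2:
  assumes z: "z \<in> Z2" and n: "tri n \<le> N"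
    and eq: "(int (z (tri n)) + k) div 2 ^ tri n = (int (z (tri n)) + l) div 2 ^ tri n"
  shows "(int (z N) + k) div 2 ^ tri n = (int (z N) + l) div 2 ^ tri n"
proof -
  have "int (z N) = int (z N) div 2 ^ tri n * 2 ^ tri n + int (z (tri n))"
    using div_mult_mod_eq[of "int (z N)" "2 ^ tri n"] Z2_mod_int[OF z n] by simp
  then obtain e where e: "int (z N) = e * 2 ^ tri n + int (z (tri n))" by blast
  have "(int (z N) + j) div 2 ^ tri n = e + (int (z (tri n)) + j) div 2 ^ tri n" for j
  proof -
    have "int (z N) + j = int (z (tri n)) + j + e * 2 ^ tri n" by (simp add: e)
    then show ?thesis by (simp only: div_mult_self1 power_not_zero zero_neq_numeral not_False_eq_True)
  qed
  then show ?thesis using eq by simp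
qed

text \<open>Blocks are compared at level \<open>tri n\<close>, but the \<open>m\<close>-th digit is
  read at level \<open>tri (Suc m)\<close>; \<open>div_eq_Z2\<close> lifts the comparison to that
  level.\<close>

lemma max_digit_Z2_block:
  assumes z: "z \<in> Z2" and n: "n \<le> m"
    and eq: "(int (z (tri n)) + k) div 2 ^ tri n = (int (z (tri n)) + l) div 2 ^ tri n"
  shows "max_digit m (int (z (tri (Suc m))) + k) \<longleftrightarrow> max_digit m (int (z (tri (Suc m))) + l)"
  by (rule max_digit_block[OF div_eq_Z2[OF z _ eq] n]) (use n in \<open>simp add: tri_mono\<close>)

text \<open>A step shorter than a block of rank \<open>n\<close> ends in the block of
  \<open>k\<close> or in the next one. As the \<open>n\<close>-th digit at \<open>k\<close> is not
  maximal, moving to the next one causes no carry, so the block of rank \<open>n + 1\<close> is the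
  same.\<close>

lemma common_block:
  assumes z: "z \<in> Z2" and k: "\<not> hit z k" and kl: "k \<le> l" "l < k + 2 ^ tri n"
  shows "(int (z (tri (Suc n))) + k) div 2 ^ tri (Suc n) = (int (z (tri (Suc n))) + l) div 2 ^ tri (Suc n)"
proof -
  let ?h = "2 ^ tri n :: int" and ?q = "2 ^ Suc n :: int"
  define c where "c = int (z (tri (Suc n)))"
  define v where "v = (c + k) div ?h"
  have v: "v mod ?q \<noteq> ?q - 1" using k by (auto simp: hit_def max_digit_def c_def v_def)
  have "(c + l) div ?h \<le> (c + k + ?h) div ?h"
    using kl by (intro zdiv_mono1) auto
  then have "(c + l) div ?h \<le> v + 1" by (simp add: v_def)
  moreover have "v \<le> (c + l) div ?h" unfolding v_def using kl by (intro zdiv_mono1) auto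
  moreover have "(v + 1) div ?q = v div ?q" by (rule div_add_one[OF _ v]) simp
  moreover have "(c + l) div ?h = v \<or> (c + l) div ?h = v + 1"
    using calculation(1,2) by linarith
  ultimately have "(c + l) div ?h div ?q = v div ?q" by metis
  moreover have "a div 2 ^ tri (Suc n) = a div ?h div ?q" for a :: int
    unfolding power_tri_Suc by (rule zdiv_zmult2_eq) simp
  ultimately show ?thesis unfolding v_def c_def by simp
qed

lemma common_block_exists:
  assumes z: "z \<in> Z2" and "\<not> hit z k" "\<not> hit z l"
  shows "\<exists>n. (int (z (tri n)) + k) div 2 ^ tri n = (int (z (tri n)) + l) div 2 ^ tri n"
proof -
  obtain n :: nat where n: "nat \<bar>l - k\<bar> \<le> n" by blast
  have "int (nat \<bar>l - k\<bar>) < 2 ^ tri n"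
  proof -
    have "nat \<bar>l - k\<bar> \<le> tri n" using n le_tri[of n] by linarith
    also have "\<dots> < 2 ^ tri n" by (rule less_exp)
    finally show ?thesis by (metis of_nat_less_iff of_nat_numeral of_nat_power)
  qed
  then have "k \<le> l \<and> l < k + 2 ^ tri n \<or> l \<le> k \<and> k < l + 2 ^ tri n" by linarith
  then show ?thesis using common_block[OF z] assms by metis
qed

text \<open>If the phases \<open>z\<close> and \<open>w\<close> agree at level \<open>n\<close> but not at level \<open>n + 1\<close>, changing only the
  \<open>n\<close>-th digit of a position \<open>l\<close> where \<open>z\<close> has no maximal digit makes that digit maximal for
  \<open>w\<close>, but not for \<open>z\<close>.\<close>

lemma recognizability:
  assumes z: "z \<in> Z2" and w: "w \<in> Z2" and l: "\<not> hit z l"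
    and H: "\<And>k m. \<bar>k - l\<bar> < 2 ^ tri n \<Longrightarrow> m < n \<Longrightarrow> max_digit m (int (w (tri (Suc m))) + k) \<Longrightarrow> hit z k"
  shows "z (tri n) = w (tri n)"
  using H
proof (induction n)
  case 0
  then show ?case using z w by (auto simp: Z2_def tri_def dest!: spec[of _ 0])
next
  case (Suc n)
  let ?h = "2 ^ tri n :: int" and ?q = "2 ^ Suc n :: int"
  have hq: "2 ^ tri (Suc n) = ?h * ?q" by (rule power_tri_Suc)
  have IH: "z (tri n) = w (tri n)"
  proof (rule Suc.IH)
    fix k m assume "\<bar>k - l\<bar> < ?h" "m < n" and m: "max_digit m (int (w (tri (Suc m))) + k)"
    moreover have "?h \<le> 2 ^ tri (Suc n)" by (simp add: tri_mono)
    ultimately show "hit z k" using Suc.prems[OF _ _ m] by linarith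
  qed
  define c d where "c = int (z (tri (Suc n)))" and "d = int (w (tri (Suc n)))"
  have cd: "0 \<le> c" "c < ?h * ?q" "0 \<le> d" "d < ?h * ?q"
    unfolding c_def d_def hq[symmetric] using Z2_less_int[OF z] Z2_less_int[OF w] by simp_all
  have "c mod ?h = d mod ?h"
    unfolding c_def d_def using Z2_mod_int[OF z] Z2_mod_int[OF w] IH tri_mono[of n "Suc n"] by simp
  \<comment> \<open>\<open>e\<close> is the difference of the \<open>n\<close>-th digits of the two
    phases. Both digits lie below \<open>?q\<close>, so \<open>?q\<close> divides \<open>e\<close>
    only if \<open>e = 0\<close>.\<close>
  then obtain e where e: "d = c + ?h * e"
    by (metis mod_eq_dvd_iff dvd_def add.commute diff_add_cancel)
  have e': "e = 0" if "?q dvd e"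
  proof -
    have "\<bar>?h * e\<bar> < ?h * ?q" using cd e by linarith
    then have "\<bar>e\<bar> < \<bar>?q\<bar>" by (simp add: abs_mult del: power_Suc)
    then show ?thesis using that dvd_imp_le_int[of e ?q] by linarith
  qed
  show ?case
  proof (rule ccontr)
    assume "z (tri (Suc n)) \<noteq> w (tri (Suc n))"
    then have e0: "\<not> ?q dvd e" using e e' by (auto simp: c_def d_def)
    define v where "v = (c + l) div ?h"
    \<comment> \<open>\<open>j\<close> gives \<open>v + e + j\<close> the residue
      \<open>?q - 1\<close>, so the \<open>n\<close>-th digit of \<open>d + k\<close> is maximal. It
      leaves \<open>v div ?q\<close> alone, so for \<open>z\<close> the position \<open>k\<close>
      stays in the block of rank \<open>n + 1\<close> of \<open>l\<close>.\<close>
    define j where "j = (?q - 1 - e) mod ?q - v mod ?q"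
    define k where "k = l + ?h * j"
    have q0: "0 < ?q" by simp
    have "0 \<le> v mod ?q" "v mod ?q < ?q" "0 \<le> (?q - 1 - e) mod ?q" "(?q - 1 - e) mod ?q < ?q"
      using q0 by auto
    then have "\<bar>j\<bar> < ?q" unfolding j_def by linarith
    then have "\<bar>k - l\<bar> < 2 ^ tri (Suc n)" unfolding k_def hq by (simp add: abs_mult del: power_Suc)
    moreover have "max_digit n (d + k)"
    proof -
      have "d + k = c + l + (e + j) * ?h" by (simp add: e k_def algebra_simps)
      then have "(d + k) div ?h = v + (e + j)" unfolding v_def by simp
      moreover have "(v + (e + j)) mod ?q = ((v mod ?q) + e + j) mod ?q"
        by (metis add.assoc mod_add_left_eq)
      moreover have "\<dots> = (?q - 1) mod ?q"
        unfolding j_def by (simp add: mod_simps del: power_Suc)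
      ultimately show ?thesis unfolding max_digit_def by (simp add: zmod_minus1 del: power_Suc)
    qed
    ultimately have "hit z k" using Suc.prems[of k n] by (simp add: d_def)
    then obtain m where m: "max_digit m (int (z (tri (Suc m))) + k)" by (auto simp: hit_def)
    have nl: "\<not> max_digit m (int (z (tri (Suc m))) + l)" using l by (auto simp: hit_def)
    have vj: "(c + k) div ?h = v + j"
    proof -
      have ck: "c + k = c + l + j * ?h" by (simp add: k_def)
      show ?thesis unfolding v_def ck by simp
    qed
    have vjq: "v + j = v div ?q * ?q + (?q - 1 - e) mod ?q"
      unfolding j_def using div_mult_mod_eq[of v ?q] by linarith
    \<comment> \<open>Lower digits are the same at \<open>k\<close> and \<open>l\<close>, which
      differ by a multiple of \<open>?h\<close>. The \<open>n\<close>-th digit for \<open>z\<close>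
      is \<open>(?q - 1 - e) mod ?q\<close>, not maximal as \<open>?q\<close> does not divide
      \<open>e\<close>. Higher digits agree on the common block of rank
      \<open>n + 1\<close>.\<close>
    consider "m < n" | "m = n" | "n < m" by linarith
    then show False
    proof cases
      case 1
      then have "(2::int) ^ tri (Suc m) dvd ?h" using tri_mono[of "Suc m" n] by (simp add: le_imp_power_dvd)
      then have "(int (z (tri (Suc m))) + k) mod 2 ^ tri (Suc m) = (int (z (tri (Suc m))) + l) mod 2 ^ tri (Suc m)"
        by (auto simp: k_def mod_eq_dvd_iff)
      then show False using m nl max_digit_cong by blast
    next
      case 2
      have "(v + j) mod ?q = (?q - 1 - e) mod ?q" unfolding vjq by (simp add: mod_simps del: power_Suc)
      then have "(?q - 1 - e) mod ?q = (?q - 1) mod ?q"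
        using m vj by (simp add: 2 max_digit_def c_def zmod_minus1 del: power_Suc)
      then have "?q dvd (?q - 1 - e) - (?q - 1)" by (simp only: mod_eq_dvd_iff)
      then have "?q dvd e" by (simp del: power_Suc)
      then show False using e0 by blast
    next
      case 3
      have "(v + j) div ?q = v div ?q"
        unfolding vjq by (simp add: div_add1_eq del: power_Suc)
      then have "(c + k) div 2 ^ tri (Suc n) = (c + l) div 2 ^ tri (Suc n)"
        using vj by (simp add: hq zdiv_zmult2_eq v_def del: power_Suc)
      then have "max_digit m (int (z (tri (Suc m))) + k) \<longleftrightarrow> max_digit m (int (z (tri (Suc m))) + l)"
        unfolding c_def using 3 by (intro max_digit_Z2_block[OF z]) auto
      then show False using m nl by blast
    qed
  qed
qed

text \<open>Turns the phase at level \<open>n\<close> into countably many conditions on hits, the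
  form in which \<open>address\<close> is shown to be measurable. Forwards, the low digits of
  \<open>z + k\<close> and \<open>r + k\<close> agree; backwards it is
  \<open>recognizability\<close>.\<close>

lemma recognizability_nat:
  assumes z: "z \<in> Z2" and l: "\<not> hit z l" and r: "r < 2 ^ tri n"
  shows "z (tri n) = r \<longleftrightarrow> (\<forall>k. \<forall>m<n. max_digit m (int r + k) \<longrightarrow> hit z k)"
proof
  assume r: "z (tri n) = r"
  show "\<forall>k. \<forall>m<n. max_digit m (int r + k) \<longrightarrow> hit z k"
  proof (intro allI impI)
    fix k m assume "m < n" "max_digit m (int r + k)"
    then have "max_digit m (int (z (tri (Suc m))) + k)"
      using max_digit_Z2[OF z tri_mono[of "Suc m" n], of k] r by simp
    then show "hit z k" unfolding hit_def by blast
  qed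
next
  assume R: "\<forall>k. \<forall>m<n. max_digit m (int r + k) \<longrightarrow> hit z k"
  have *: "max_digit m (int (r mod 2 ^ tri (Suc m)) + k) \<longleftrightarrow> max_digit m (int r + k)" for m k
    by (rule max_digit_cong) (simp add: of_nat_mod mod_add_left_eq)
  then have "z (tri n) = r mod 2 ^ tri n"
  proof (intro recognizability[OF z Z2_of_nat l])
    fix k m assume "m < n" "max_digit m (int (r mod 2 ^ tri (Suc m)) + k)"
    then show "hit z k" using R * by simp
  qed
  then show "z (tri n) = r" using r by simp
qed

section \<open>Injectivity and equivariance of the coding\<close>

lemma Z2_eqI:
  assumes "z \<in> Z2" "w \<in> Z2" "\<And>n. z (tri n) = w (tri n)" shows "z = w"
proof
  show "z n = w n" for n
    using Z2_mod[OF assms(1) le_tri] Z2_mod[OF assms(2) le_tri] assms(3) by metis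
qed

lemma coding_eq_0_iff: "coding z k = 0 \<longleftrightarrow> \<not> hit z k"
  by (simp add: coding_def)

text \<open>The zero at \<open>l\<close> is the anchor for \<open>recognizability\<close>, whose
  hypothesis holds at every level because both codings have the same hits.\<close>

lemma coding_inj:
  assumes z: "z \<in> Z2" and w: "w \<in> Z2" and eq: "coding z = coding w" and l: "coding z l = 0"
  shows "z = w"
proof (rule Z2_eqI[OF z w])
  fix n
  have "hit z k = hit w k" for k using eq by (metis coding_eq_0_iff)
  moreover have "\<not> hit z l" using l coding_eq_0_iff by blast
  ultimately show "z (tri n) = w (tri n)"
    by (intro recognizability[OF z w]) (auto simp: hit_def[of w])
qed

lemma shift_coding:
  assumes "z \<in> Z2" shows "shift (coding z) = coding (odometer z)"
proof -
  have "max_digit m (int (odometer z (tri (Suc m))) + k) \<longleftrightarrow> max_digit m (int (z (tri (Suc m))) + (k + 1))" for m k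
  proof (rule max_digit_cong)
    have "int (odometer z n) = (int (z n) + 1) mod 2 ^ n" for n
      by (simp add: odometer_def Z2_add_def Z2_one_def of_nat_mod mod_simps)
    then show "(int (odometer z (tri (Suc m))) + k) mod 2 ^ tri (Suc m) =
        (int (z (tri (Suc m))) + (k + 1)) mod 2 ^ tri (Suc m)"
      by (simp add: mod_simps add_ac)
  qed
  then show ?thesis by (simp add: shift_def coding_def hit_def fun_eq_iff)
qed

text \<open>The digit is 0 or 1, while for \<open>0 < m\<close> the maximal digit is at least 3. For
  \<open>m = 0\<close> the digit 1 would be maximal.\<close>

lemma not_max_digit_less_twice:
  assumes "0 \<le> a" "a < 2 * 2 ^ tri m" "0 < m"
  shows "\<not> max_digit m a"
proof -
  let ?h = "2 ^ tri m :: int" and ?q = "2 ^ Suc m :: int"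
  have "2 ^ Suc 1 \<le> ?q" using assms(3) by (intro power_increasing) auto
  then have q: "4 \<le> ?q" by simp
  have "a div ?h < 2"
  proof (rule ccontr)
    assume "\<not> a div ?h < 2"
    then have "2 * ?h \<le> a div ?h * ?h" by (intro mult_right_mono) auto
    also have "\<dots> \<le> a" using div_mult_mod_eq[of a ?h] pos_mod_sign[of ?h a, OF zero_less_power] by linarith
    finally show False using assms(2) by simp
  qed
  moreover have "0 \<le> a div ?h" using assms(1) by (simp add: pos_imp_zdiv_nonneg_iff)
  ultimately have "a div ?h mod ?q < 2" using q by (simp del: power_Suc)
  then show ?thesis unfolding max_digit_def using q by linarith
qed

section \<open>Codings and points of the orbit closure\<close>

locale rank_one_subshift =
  fixes u :: "nat \<Rightarrow> nat"
  assumes initial_blocks: "\<forall>n. has_initial_block u (rank_block n)"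
begin

lemma u_eq: "u j = of_bool (\<exists>m. max_digit m (int j))"
  by (rule initial_blocks_eq_coding[OF initial_blocks])

text \<open>The window is found in \<open>u\<close> at the residue \<open>c\<close> of
  \<open>z + i\<close> at a high level \<open>N\<close>. Digits below the \<open>N\<close>-th agree
  with those of \<open>z\<close>; the others are too small to be maximal, even if
  \<open>c + t\<close> runs past the first block of rank \<open>N\<close>.\<close>

lemma coding_in_orbit_closure:
  assumes z: "z \<in> Z2" shows "coding z \<in> orbit_closure u"
proof -
  have "\<exists>j. \<forall>t<L. coding z (i + int t) = u (j + t)" for i L
  proof -
    have "\<forall>t. \<exists>m. hit z (i + int t) \<longrightarrow> max_digit m (int (z (tri (Suc m))) + (i + int t))"
      unfolding hit_def by blast
    then obtain f where f: "\<And>t. hit z (i + int t) \<Longrightarrow> max_digit (f t) (int (z (tri (Suc (f t)))) + (i + int t))"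
      by metis
    \<comment> \<open>\<open>N\<close> exceeds the witnesses of all hits in the window, makes
      \<open>2 ^ tri N\<close> exceed the offsets \<open>t\<close>, and is positive, as
      \<open>not_max_digit_less_twice\<close> requires.\<close>
    define N where "N = Suc (sum f {..<L}) + L"
    have fN: "f t < N" if "t < L" for t
      using member_le_sum[of t "{..<L}" f] that by (simp add: N_def)
    have LN: "int t < 2 ^ tri N" if "t < L" for t
    proof -
      have "t < tri N" using that le_tri[of N] by (simp add: N_def)
      also have "\<dots> < 2 ^ tri N" by (rule less_exp)
      finally show ?thesis by (metis of_nat_less_iff of_nat_numeral of_nat_power)
    qed
    define c where "c = (int (z (tri N)) + i) mod 2 ^ tri N"
    have c: "0 \<le> c" "c < 2 ^ tri N" by (simp_all add: c_def)
    have "coding z (i + int t) = u (nat c + t)" if t: "t < L" for t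
    proof -
      have low: "max_digit m (c + int t) \<longleftrightarrow> max_digit m (int (z (tri (Suc m))) + (i + int t))" if "m < N" for m
      proof -
        have le: "tri (Suc m) \<le> tri N" using that by (simp add: tri_mono)
        have "c mod 2 ^ tri (Suc m) = (int (z (tri N)) + i) mod 2 ^ tri (Suc m)"
          unfolding c_def by (rule mod_mod_cancel) (rule le_imp_power_dvd[OF le])
        then have "(c + int t) mod 2 ^ tri (Suc m) = (int (z (tri N)) + (i + int t)) mod 2 ^ tri (Suc m)"
          by (metis mod_add_left_eq add.assoc)
        then show ?thesis
          using max_digit_cong max_digit_Z2[OF z le] by blast
      qed
      have high: "\<not> max_digit m (c + int t)" if "N \<le> m" for m
      proof (rule not_max_digit_less_twice)
        have "c + int t < 2 * 2 ^ tri N" using c LN[OF t] by linarith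
        also have "(2::int) * 2 ^ tri N \<le> 2 * 2 ^ tri m" using that by (simp add: tri_mono)
        finally show "c + int t < 2 * 2 ^ tri m" .
        show "0 < m" using that by (simp add: N_def)
      qed (use c in simp)
      have "(\<exists>m. max_digit m (c + int t)) \<longleftrightarrow> hit z (i + int t)"
        using low high f fN[OF t] unfolding hit_def by (metis not_le)
      moreover have "int (nat c + t) = c + int t" using c by simp
      ultimately show ?thesis by (simp add: coding_def u_eq)
    qed
    then show ?thesis by blast
  qed
  moreover have "\<forall>k. coding z k \<in> {0, 1}" by (simp add: coding_def)
  ultimately show ?thesis by (simp add: orbit_closure_def)
qed

text \<open>Windows of \<open>x\<close> around the origin are windows of \<open>u\<close>, i.e. of codings of natural numbers
  \<open>y N\<close>; by recognizability the residues of \<open>y N\<close> stabilize, so no compactness argument is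
  needed to find the limit.\<close>

lemma ex_coding:
  assumes x: "x \<in> orbit_closure u" and l: "x l = 0"
  shows "\<exists>z\<in>Z2. coding z = x"
proof -
  have "\<forall>N. \<exists>j. \<forall>t<2 * N. x (- int N + int t) = u (j + t)"
    using x unfolding orbit_closure_def by blast
  then obtain j where j: "\<And>N t. t < 2 * N \<Longrightarrow> x (- int N + int t) = u (j N + t)" by metis
  \<comment> \<open>The window starting at \<open>- int N\<close> matches \<open>u\<close> from
    \<open>j N\<close> on, so the origin of \<open>x\<close> sits at index
    \<open>j N + N\<close>.\<close>
  define y where "y N = (\<lambda>n. (j N + N) mod 2 ^ n)" for N
  have y: "y N \<in> Z2" for N unfolding y_def by (rule Z2_of_nat)
  have xy: "x k = coding (y N) k" if "\<bar>k\<bar> < int N" for N k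
  proof -
    have nn: "0 \<le> k + int N" using that by linarith
    then have "x k = x (- int N + int (nat (k + int N)))" by simp
    also have "\<dots> = u (j N + nat (k + int N))" using that by (intro j) linarith
    also have "\<dots> = of_bool (\<exists>m. max_digit m (int (j N + N) + k))"
      using nn by (simp add: u_eq algebra_simps)
    finally show ?thesis unfolding coding_def y_def hit_nat .
  qed
  \<comment> \<open>A window of radius \<open>M n\<close> contains all positions at distance less
    than \<open>2 ^ tri n\<close> from \<open>l\<close>, the range that
    \<open>recognizability\<close> inspects.\<close>
  define M where "M n = nat (\<bar>l\<bar> + 2 ^ tri n) + 1" for n
  have M_gt: "\<bar>l\<bar> < int (M n)" for n
    using zero_less_power[of "2::int" "tri n"] unfolding M_def by linarith
  have M_le: "M m \<le> M n" if "m \<le> n" for m n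
    unfolding M_def using tri_mono[OF that] by (simp add: nat_mono)
  have stable: "y N (tri n) = y N' (tri n)" if N: "M n \<le> N" "M n \<le> N'" for n N N'
  proof (rule recognizability[OF y y])
    have lN: "\<bar>l\<bar> + 2 ^ tri n < int N" "\<bar>l\<bar> + 2 ^ tri n < int N'"
      using N unfolding M_def by linarith+
    have "\<bar>l\<bar> < int N" using lN(1) zero_less_power[of "2::int" "tri n"] by linarith
    then show "\<not> hit (y N) l" using xy l coding_eq_0_iff by metis
    fix k m assume k: "\<bar>k - l\<bar> < 2 ^ tri n" and m: "max_digit m (int (y N' (tri (Suc m))) + k)"
    have kN: "\<bar>k\<bar> < int N" "\<bar>k\<bar> < int N'" using k lN by linarith+
    have "hit (y N') k" using m unfolding hit_def by blast
    then show "hit (y N) k" using xy[OF kN(1)] xy[OF kN(2)] coding_eq_0_iff by metis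
  qed
  define z where "z n = y (M n) n" for n
  have zy: "z n = y N n" if "M n \<le> N" for n N
    using stable[OF order_refl that] Z2_mod[OF y le_tri] unfolding z_def by metis
  have z: "z \<in> Z2"
  proof -
    have "z (Suc n) mod 2 ^ n = z n" for n
      using zy[of n "max (M n) (M (Suc n))"] zy[of "Suc n" "max (M n) (M (Suc n))"] Z2_mod[OF y, of n "Suc n"]
      by simp
    moreover have "z n < 2 ^ n" for n by (simp add: z_def y_def)
    ultimately show ?thesis by (simp add: Z2_def)
  qed
  have l0: "\<not> hit z k" if k: "x k = 0" for k
  proof
    assume "hit z k"
    then obtain m where m: "max_digit m (int (z (tri (Suc m))) + k)" by (auto simp: hit_def)
    define N where "N = M (tri (Suc m)) + nat \<bar>k\<bar> + 1"
    have "z (tri (Suc m)) = y N (tri (Suc m))" by (rule zy) (simp add: N_def)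
    then have "hit (y N) k" using m unfolding hit_def by metis
    then show False using xy[of k N] k by (simp add: N_def coding_def)
  qed
  \<comment> \<open>Here stabilization is not enough: a hit of \<open>y N\<close> at
    \<open>k\<close> may come from a digit whose index grows with \<open>N\<close>. Digits below the
    \<open>n\<close>-th pass to \<open>z\<close>; a higher one would also be maximal at
    \<open>l\<close>, in the same block, contradicting \<open>x l = 0\<close>.\<close>
  have "x k = 0" if k: "\<not> hit z k" for k
  proof -
    obtain n where n: "(int (z (tri n)) + k) div 2 ^ tri n = (int (z (tri n)) + l) div 2 ^ tri n"
      using common_block_exists[OF z k l0[OF l]] by blast
    define N where "N = M (tri n) + nat \<bar>k\<bar> + 1"
    have zyn: "z (tri n) = y N (tri n)" by (rule zy) (simp add: N_def)
    have "\<not> hit (y N) k"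
    proof
      assume "hit (y N) k"
      then obtain m where m: "max_digit m (int (y N (tri (Suc m))) + k)" by (auto simp: hit_def)
      show False
      proof (cases "m < n")
        case True
        then have "M (tri (Suc m)) \<le> M (tri n)" by (intro M_le tri_mono) simp
        then have "z (tri (Suc m)) = y N (tri (Suc m))" by (intro zy) (simp add: N_def)
        then show False using m k unfolding hit_def by metis
      next
        case False
        then have "max_digit m (int (y N (tri (Suc m))) + l)"
          using max_digit_Z2_block[OF y, of n m N k l] n m by (simp add: zyn)
        then have "hit (y N) l" unfolding hit_def by blast
        moreover have "\<bar>l\<bar> < int N" using M_gt[of "tri n"] unfolding N_def by simp
        ultimately show False using xy[of l N] l by (simp add: coding_def)
      qed
    qed
    moreover have "\<bar>k\<bar> < int N" unfolding N_def by simp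
    ultimately show ?thesis using xy[of k N] by (simp add: coding_def)
  qed
  moreover have "x k = 0 \<or> x k = 1" for k using x unfolding orbit_closure_def by blast
  ultimately have "coding z k = x k" for k
    using l0[of k] unfolding coding_def by (metis of_bool_eq)
  then have "coding z = x" by blast
  then show ?thesis using z by blast
qed

end

section \<open>Haar measure on the odometer\<close>

lemma sets_Z2_haar: "sets Z2_haar = sets (restrict_space borel Z2)"
  using is_Z2_haar_Z2_haar by (simp add: is_Z2_haar_def)

lemma prob_space_Z2_haar: "prob_space Z2_haar"
  using is_Z2_haar_Z2_haar Z2_one_in by (auto simp: is_Z2_haar_def invariant_prob_def)

lemma space_Z2_haar: "space Z2_haar = Z2"
  by (rule Z2_space[OF sets_Z2_haar])

lemma coordinate_measurable_Z2_haar [measurable]: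
  "(\<lambda>z. z n) \<in> measurable Z2_haar (count_space UNIV)"
  by (rule Z2_coord_measurable[OF sets_Z2_haar])

lemma measure_Z2_haar_cylinder:
  assumes "a < 2 ^ n" shows "measure Z2_haar {z\<in>Z2. z n = a} = 1 / 2 ^ n"
proof -
  have "1 / 2 ^ n = ennreal (1 / 2 ^ n)"
    by (simp add: divide_ennreal[symmetric] ennreal_power[symmetric])
  then show ?thesis
    using Z2_haar_cylinder[OF is_Z2_haar_Z2_haar assms] by (simp add: measure_def)
qed

lemma odometer_eq: "odometer = Z2_add Z2_one"
  by (simp add: fun_eq_iff odometer_def Z2_add_def add.commute)

lemma odometer_in_Z2: "z \<in> Z2 \<Longrightarrow> odometer z \<in> Z2"
  by (simp add: odometer_eq Z2_add_in Z2_one_in)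

lemma invariant_odometer: "invariant_prob Z2_haar odometer"
  using is_Z2_haar_Z2_haar Z2_one_in by (simp add: is_Z2_haar_def odometer_eq)

text \<open>Adding one permutes the \<open>2 ^ n\<close> cylinders of level \<open>n\<close>
  cyclically, so invariance under this single translation forces equal masses.\<close>

lemma Z2_haar_unique:
  assumes \<nu>: "sets \<nu> = sets (restrict_space borel Z2)" and inv: "invariant_prob \<nu> odometer"
  shows "\<nu> = Z2_haar"
proof -
  interpret \<nu>: prob_space \<nu> using inv by (simp add: invariant_prob_def)
  note sp = Z2_space[OF \<nu>]
  have s: "{x\<in>Z2. x n = c} \<in> sets \<nu>" for n c
    using Z2_cylinder_sets[OF \<nu>, of n "{c}"] by auto
  have step: "emeasure \<nu> {x\<in>Z2. x n = Suc c} = emeasure \<nu> {x\<in>Z2. x n = c}" if c: "Suc c < 2 ^ n" for n c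
  proof -
    have "Z2_one n = 1" using c by (cases n) (auto simp: Z2_one_def)
    then have "(Suc c + (2 ^ n - Z2_one n)) mod 2 ^ n = (c + 2 ^ n) mod 2 ^ n" by simp
    then have e: "(Suc c + (2 ^ n - Z2_one n)) mod 2 ^ n = c" using c by simp
    have "emeasure \<nu> {x\<in>Z2. x n = Suc c} = emeasure (distr \<nu> \<nu> odometer) {x\<in>Z2. x n = Suc c}"
      using inv by (simp add: invariant_prob_def)
    also have "\<dots> = emeasure \<nu> (odometer -` {x\<in>Z2. x n = Suc c} \<inter> space \<nu>)"
      using inv by (intro emeasure_distr s) (simp add: invariant_prob_def)
    also have "odometer -` {x\<in>Z2. x n = Suc c} \<inter> space \<nu> = {x\<in>Z2. Z2_add Z2_one x n = Suc c}"
      using odometer_in_Z2 by (auto simp: sp odometer_eq)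
    finally show ?thesis unfolding Z2_translate_cylinder[OF Z2_one_in c] e .
  qed
  have *: "emeasure \<nu> {x\<in>Z2. x n = c} = emeasure \<nu> {x\<in>Z2. x n = 0}" if "c < 2 ^ n" for n c
    using that by (induction c) (auto simp: step)
  have "is_Z2_haar \<nu>"
  proof (rule Z2_haarI[OF \<nu> \<nu>.prob_space_axioms])
    fix n a :: nat assume a: "a < 2 ^ n"
    have "1 = emeasure \<nu> Z2" using \<nu>.emeasure_space_1 sp by simp
    also have "Z2 = (\<Union>c\<in>{..<2 ^ n}. {x\<in>Z2. x n = c})" by (auto simp: Z2_def)
    also have "emeasure \<nu> \<dots> = (\<Sum>c<2 ^ n. emeasure \<nu> {x\<in>Z2. x n = c})"
      by (rule sum_emeasure[symmetric]) (use s in \<open>auto simp: disjoint_family_on_def\<close>)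
    also have "\<dots> = (\<Sum>c<(2::nat) ^ n. emeasure \<nu> {x\<in>Z2. x n = a})"
      by (rule sum.cong[OF refl], rule trans[OF * *[OF a, symmetric]]) simp
    also have "\<dots> = 2 ^ n * emeasure \<nu> {x\<in>Z2. x n = a}" by simp
    finally have "1 / 2 ^ n = emeasure \<nu> {x\<in>Z2. x n = a} * 2 ^ n / 2 ^ n"
      by (simp add: mult.commute)
    also have "\<dots> = emeasure \<nu> {x\<in>Z2. x n = a}"
      by (rule ennreal_mult_divide_eq) (simp_all add: power_eq_top_ennreal)
    finally show "emeasure \<nu> {x\<in>Z2. x n = a} = 1 / 2 ^ n" ..
  qed
  then show ?thesis using ex1_Z2_haar is_Z2_haar_Z2_haar by blast
qed

text \<open>A maximal \<open>m\<close>-th digit puts the residue at level \<open>tri (Suc m)\<close>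
  among the top \<open>2 ^ tri m\<close> values. The bounds are summable, as Borel--Cantelli
  requires.\<close>

lemma measure_max_digit_le:
  "measure Z2_haar {z\<in>Z2. max_digit m (int (z (tri (Suc m))))} \<le> (1 / 2) ^ Suc m"
proof -
  interpret prob_space Z2_haar by (rule prob_space_Z2_haar)
  let ?T = "tri (Suc m)" and ?h = "2 ^ tri m :: nat" and ?q = "2 ^ Suc m :: nat"
  let ?C = "\<lambda>a. {z\<in>Z2. z ?T = a}"
  have T: "?h * ?q = 2 ^ ?T" by (simp add: tri_Suc power_add)
  have sub: "{z\<in>Z2. max_digit m (int (z ?T))} \<subseteq> (\<Union>a\<in>{?h * (?q - 1)..<?h * ?q}. ?C a)"
  proof safe
    fix z assume z: "z \<in> Z2" and m: "max_digit m (int (z ?T))"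
    have "(z ?T div ?h) mod ?q = ?q - 1"
    proof -
      have "int ((z ?T div ?h) mod ?q) = int ?q - 1"
        using m by (simp add: max_digit_def zdiv_int zmod_int)
      then show ?thesis by linarith
    qed
    then have "?q - 1 \<le> z ?T div ?h" by (metis mod_less_eq_dividend)
    then have "?h * (?q - 1) \<le> ?h * (z ?T div ?h)" by (rule mult_le_mono2)
    also have "\<dots> \<le> z ?T" by simp
    finally have "?h * (?q - 1) \<le> z ?T" .
    moreover have "z ?T < ?h * ?q" using z unfolding T by (simp add: Z2_def)
    ultimately show "z \<in> (\<Union>a\<in>{?h * (?q - 1)..<?h * ?q}. ?C a)" using z by simp
  qed
  have s: "?C a \<in> events" for a
    using Z2_cylinder_sets[OF sets_Z2_haar, of ?T "{a}"] by simp
  have "prob {z\<in>Z2. max_digit m (int (z ?T))} \<le> prob (\<Union>a\<in>{?h * (?q - 1)..<?h * ?q}. ?C a)"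
    by (rule finite_measure_mono[OF sub]) (use s in auto)
  also have "\<dots> \<le> (\<Sum>a\<in>{?h * (?q - 1)..<?h * ?q}. prob (?C a))"
    by (rule finite_measure_subadditive_finite) (use s in auto)
  also have "\<dots> = (\<Sum>a\<in>{?h * (?q - 1)..<?h * ?q}. 1 / 2 ^ ?T)"
    by (rule sum.cong[OF refl], rule measure_Z2_haar_cylinder) (simp add: T[symmetric])
  also have "\<dots> = real ?h / 2 ^ ?T"
    by (simp add: diff_mult_distrib2[symmetric] del: power_Suc)
  also have "\<dots> = (1 / 2) ^ Suc m" by (simp add: tri_Suc power_add power_one_over)
  finally show ?thesis .
qed

lemma AE_not_hit: "AE z in Z2_haar. \<exists>k. \<not> hit z k"
proof -
  interpret prob_space Z2_haar by (rule prob_space_Z2_haar)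
  let ?E = "\<lambda>m. {z\<in>Z2. max_digit m (int (z (tri (Suc m))))}"
  have "AE z in Z2_haar. eventually (\<lambda>m. z \<in> space Z2_haar - ?E m) sequentially"
  proof (rule borel_cantelli_AE1)
    show "?E m \<in> events" for m
      using Z2_cylinder_sets[OF sets_Z2_haar, of "tri (Suc m)" "{a. max_digit m (int a)}"] by simp
    show "emeasure Z2_haar (?E m) < \<infinity>" for m by (simp add: less_top[symmetric])
    show "summable (\<lambda>m. measure Z2_haar (?E m))"
      by (rule summable_comparison_test'[of "\<lambda>m. (1 / 2) ^ Suc m" 0])
        (use measure_max_digit_le in \<open>auto simp: summable_geometric\<close>)
  qed
  then show ?thesis
  proof (rule AE_mp, intro AE_I2 impI)
    fix z assume "z \<in> space Z2_haar" and "eventually (\<lambda>m. z \<in> space Z2_haar - ?E m) sequentially"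
    then obtain N where z: "z \<in> Z2"
      and N: "\<And>m. N \<le> m \<Longrightarrow> \<not> max_digit m (int (z (tri (Suc m))))"
      by (auto simp: space_Z2_haar eventually_sequentially)
    \<comment> \<open>Subtracting this residue turns the digits below the \<open>N\<close>-th into 0
      without borrowing, so the higher digits are kept.\<close>
    define k where "k = - int (z (tri N))"
    have "\<not> max_digit m (int (z (tri (Suc m))) + k)" for m
    proof (cases "m < N")
      case True
      then have "max_digit m (int (z (tri (Suc m))) + k) \<longleftrightarrow> max_digit m (int (z (tri N)) + k)"
        by (intro max_digit_Z2[OF z, symmetric] tri_mono) simp
      then show ?thesis using not_max_digit_small[of 0 m] by (simp add: k_def)
    next
      case False
      have "max_digit m (int (z (tri (Suc m))) + k) \<longleftrightarrow> max_digit m (int (z (tri (Suc m))) + 0)"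
        using False Z2_less_int[OF z, of "tri N"]
        by (intro max_digit_Z2_block[OF z, of N]) (auto simp: k_def)
      then show ?thesis using N False by simp
    qed
    then show "\<exists>k. \<not> hit z k" unfolding hit_def by blast
  qed
qed

lemma hit_measurable [measurable]: "Measurable.pred Z2_haar (\<lambda>z. hit z k)"
  unfolding hit_def
  by (intro pred_intros_countable measurable_compose[OF coordinate_measurable_Z2_haar]) simp

section \<open>Measurability in sequence spaces, and atoms\<close>

lemma coordinate_measurable:
  fixes \<mu> :: "(int \<Rightarrow> nat) measure"
  assumes "sets \<mu> = sets (restrict_space borel X)"
  shows "(\<lambda>x. x k) \<in> measurable \<mu> (count_space UNIV)"
proof -
  have "(\<lambda>x::int \<Rightarrow> nat. x k) \<in> borel_measurable borel"
    by (intro borel_measurable_continuous_onI continuous_on_product_coordinates)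
  then have "(\<lambda>x::int \<Rightarrow> nat. x k) \<in> measurable borel (count_space UNIV)"
    by (simp add: measurable_cong_sets[OF refl sets_borel_eq_count_space])
  then show ?thesis
    using measurable_cong_sets[OF assms refl] by (auto intro: measurable_restrict_space1)
qed

lemma measurable_coordinatesI:
  fixes \<mu> :: "(int \<Rightarrow> nat) measure"
  assumes \<mu>: "sets \<mu> = sets (restrict_space borel X)"
    and f: "\<And>x. x \<in> space M \<Longrightarrow> f x \<in> X"
    and c: "\<And>k. (\<lambda>x. f x k) \<in> measurable M (count_space UNIV)"
  shows "f \<in> measurable M \<mu>"
proof -
  have "(\<lambda>x. f x k) \<in> borel_measurable M" for k
    using c[of k] by (simp add: measurable_cong_sets[OF refl sets_borel_eq_count_space])
  then have "f \<in> borel_measurable M" by (rule measurable_coordinatewise_then_product)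
  then have "f \<in> measurable M (restrict_space borel X)"
    using f by (intro measurable_restrict_space2) auto
  then show ?thesis using measurable_cong_sets[OF refl \<mu>] by blast
qed

lemma emeasure_nonatomic_singleton:
  assumes "nonatomic M" "A \<in> sets M" "A \<subseteq> {p}" shows "emeasure M A = 0"
proof (rule ccontr)
  assume "emeasure M A \<noteq> 0"
  then obtain B where B: "B \<subseteq> A" "0 < emeasure M B" "emeasure M B < emeasure M A"
    using assms unfolding nonatomic_def by (meson not_gr_zero)
  then have "B = {} \<or> B = A" using assms(3) by blast
  then show False using B by auto
qed

section \<open>The address of a point of the orbit closure\<close>

text \<open>On the orbit closure, the junk value \<open>0\<close> is used only for the constant sequence \<open>1\<close>.\<close>

definition address :: "(int \<Rightarrow> nat) \<Rightarrow> nat \<Rightarrow> nat" where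
  "address x = (if \<exists>k. x k = 0 then (THE z. z \<in> Z2 \<and> coding z = x) else (\<lambda>_. 0))"

lemma address_no_zero: "\<nexists>k. x k = 0 \<Longrightarrow> address x = (\<lambda>_. 0)"
  unfolding address_def by (rule if_not_P)

lemma address_coding:
  assumes "z \<in> Z2" "\<not> hit z k" shows "address (coding z) = z"
proof -
  have k: "coding z k = 0" using assms by (simp add: coding_eq_0_iff)
  then have "(THE w. w \<in> Z2 \<and> coding w = coding z) = z"
    using assms(1) coding_inj by (intro the_equality) metis+
  moreover have "\<exists>k. coding z k = 0" using k by blast
  ultimately show ?thesis unfolding address_def by simp
qed

context rank_one_subshift
begin

abbreviation X where "X \<equiv> orbit_closure u"

lemma shift_in: "x \<in> X \<Longrightarrow> shift x \<in> X"
proof -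
  assume x: "x \<in> X"
  have "\<exists>j. \<forall>t<n. x (i + int t + 1) = u (j + t)" for i n
    using x unfolding orbit_closure_def by (auto simp: add_ac dest!: spec[of _ "i + 1"])
  then show ?thesis using x by (simp add: orbit_closure_def shift_def)
qed

lemma address_in:
  assumes "x \<in> X" shows "address x \<in> Z2"
proof (cases "\<exists>k. x k = 0")
  case True
  then obtain z k where "z \<in> Z2" "x = coding z" "x k = 0" using ex_coding[OF assms] by blast
  then show ?thesis using address_coding by (simp add: coding_eq_0_iff)
next
  case False
  then show ?thesis unfolding address_no_zero[OF False] by (simp add: Z2_def)
qed

lemma coding_address:
  assumes "x \<in> X" "x k = 0" shows "coding (address x) = x"
proof -
  obtain z where "z \<in> Z2" "x = coding z" using ex_coding[OF assms] by blast
  then show ?thesis using address_coding assms(2) by (simp add: coding_eq_0_iff)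
qed

text \<open>The zero moves to \<open>k - 1\<close>, so \<open>address_coding\<close> still applies
  after the shift. On the constant sequence 1 the identity fails: the shift fixes it, but the
  odometer has no fixed point.\<close>

lemma address_shift:
  assumes x: "x \<in> X" "x k = 0" shows "address (shift x) = odometer (address x)"
proof -
  note z = address_in[OF x(1)]
  have e: "shift x = coding (odometer (address x))"
    using shift_coding[OF z] coding_address[OF x] by simp
  have "shift x (k - 1) = 0" using x(2) by (simp add: shift_def)
  then have "\<not> hit (odometer (address x)) (k - 1)" unfolding e by (simp add: coding_eq_0_iff)
  then show ?thesis unfolding e by (rule address_coding[OF odometer_in_Z2[OF z]])
qed

text \<open>The right-hand side combines countably many conditions on coordinates, which yields
  measurability. The last disjunct accounts for the default value on the constant sequence
  1.\<close>

lemma address_eq_iff: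
  assumes x: "x \<in> X"
  shows "address x (tri n) = a \<longleftrightarrow>
    (\<exists>k. x k = 0) \<and> a < 2 ^ tri n \<and> (\<forall>k. \<forall>m<n. max_digit m (int a + k) \<longrightarrow> x k = 1) \<or>
    (\<forall>k. x k \<noteq> 0) \<and> a = 0"
proof (cases "\<exists>k. x k = 0")
  case True
  then obtain l where l: "x l = 0" ..
  note z = address_in[OF x]
  have h: "hit (address x) k \<longleftrightarrow> x k = 1" for k
    using coding_address[OF x l, THEN fun_cong, of k] unfolding coding_def by (metis of_bool_eq_1_iff)
  have "address x (tri n) = a \<longleftrightarrow> (\<forall>k. \<forall>m<n. max_digit m (int a + k) \<longrightarrow> x k = 1)" if "a < 2 ^ tri n"
    using recognizability_nat[OF z _ that, of l] l by (simp add: h)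
  moreover have "address x (tri n) < 2 ^ tri n" using z by (simp add: Z2_def)
  moreover have "\<not> (\<forall>k. x k \<noteq> 0)" using True by blast
  ultimately show ?thesis using True by metis
next
  case False
  then have nz: "(\<exists>k. x k = 0) \<longleftrightarrow> False" "(\<forall>k. x k \<noteq> 0) \<longleftrightarrow> True"
    by (simp_all del: neq0_conv)
  show ?thesis unfolding address_no_zero[OF False] nz by auto
qed

lemma address_measurable:
  assumes \<mu>: "sets \<mu> = sets (restrict_space borel X)"
  shows "address \<in> measurable \<mu> Z2_haar"
proof (rule Z2_measurableI[OF sets_Z2_haar])
  have sp: "space \<mu> = X" using sets_eq_imp_space_eq[OF \<mu>] by (simp add: space_restrict_space)
  show "address x \<in> Z2" if "x \<in> space \<mu>" for x using that sp address_in by blast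
  fix n
  note [measurable] = coordinate_measurable[OF \<mu>]
  have "(\<lambda>x. address x (tri n)) \<in> measurable \<mu> (count_space UNIV)"
  proof (subst measurable_count_space_eq2_countable, intro conjI ballI)
    fix a
    have "(\<lambda>x. address x (tri n)) -` {a} \<inter> space \<mu> = {x\<in>space \<mu>. address x (tri n) = a}"
      by auto
    also have "\<dots> = {x\<in>space \<mu>.
        (\<exists>k. x k = 0) \<and> a < 2 ^ tri n \<and> (\<forall>k. \<forall>m<n. max_digit m (int a + k) \<longrightarrow> x k = 1) \<or>
        (\<forall>k. x k \<noteq> 0) \<and> a = 0}"
      by (rule Collect_cong, rule conj_cong[OF refl], rule address_eq_iff) (simp add: sp)
    also have "\<dots> \<in> sets \<mu>" by measurable
    finally show "(\<lambda>x. address x (tri n)) -` {a} \<inter> space \<mu> \<in> sets \<mu>" .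
  qed simp
  \<comment> \<open>As \<open>n\<close> is at most \<open>tri n\<close>, every level is a reduction
    of one of the form \<open>tri n\<close>.\<close>
  then have "(\<lambda>x. address x (tri n) mod 2 ^ n) \<in> measurable \<mu> (count_space UNIV)"
    by (rule measurable_compose) simp
  also have "?this \<longleftrightarrow> (\<lambda>x. address x n) \<in> measurable \<mu> (count_space UNIV)"
    by (rule measurable_cong) (use Z2_mod[OF address_in le_tri] sp in blast)
  finally show "(\<lambda>x. address x n) \<in> measurable \<mu> (count_space UNIV)" .
qed

lemma coding_measurable:
  assumes \<mu>: "sets \<mu> = sets (restrict_space borel X)"
  shows "coding \<in> measurable Z2_haar \<mu>"
proof (rule measurable_coordinatesI[OF \<mu>])
  show "coding z \<in> X" if "z \<in> space Z2_haar" for z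
    using that by (simp add: space_Z2_haar coding_in_orbit_closure)
  show "(\<lambda>z. coding z k) \<in> measurable Z2_haar (count_space UNIV)" for k
    unfolding coding_def by (rule measurable_compose[OF hit_measurable]) simp
qed

end

section \<open>Invariant measures on the orbit closure\<close>

context rank_one_subshift
begin

lemma orbit_closure_space:
  assumes "sets \<mu> = sets (restrict_space borel X)" shows "space \<mu> = X"
  using sets_eq_imp_space_eq[OF assms] by (simp add: space_restrict_space)

lemma zero_set_measurable:
  assumes "sets \<mu> = sets (restrict_space borel X)"
  shows "{x\<in>X. \<exists>k. x k = 0} \<in> sets \<mu>"
proof -
  note [measurable] = coordinate_measurable[OF assms]
  have "{x\<in>space \<mu>. \<exists>k. x k = 0} \<in> sets \<mu>" by measurable
  then show ?thesis by (simp add: orbit_closure_space[OF assms])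
qed

lemma AE_zero:
  assumes "nonatomic_invariant_measure X \<mu>"
  shows "AE x in \<mu>. \<exists>k. x k = 0"
proof -
  have \<mu>: "sets \<mu> = sets (restrict_space borel X)" and na: "nonatomic \<mu>"
    using assms by (auto simp: nonatomic_invariant_measure_def)
  let ?A = "{x\<in>X. \<exists>k. x k = 0}"
  have m: "X - ?A \<in> sets \<mu>"
    using sets.compl_sets[OF zero_set_measurable[OF \<mu>]] orbit_closure_space[OF \<mu>] by simp
  have "x k = 1" if "x \<in> X - ?A" for x k
    using that unfolding orbit_closure_def by blast
  then have "X - ?A \<subseteq> {\<lambda>_. 1}" by blast
  then have "emeasure \<mu> (X - ?A) = 0" by (rule emeasure_nonatomic_singleton[OF na m])
  then show ?thesis
    by (intro AE_I[OF _ _ m]) (auto simp: orbit_closure_space[OF \<mu>] simp del: neq0_conv)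
qed

text \<open>\<open>address\<close> intertwines shift and odometer almost everywhere, so the image
  measure is odometer-invariant and \<open>Z2_haar_unique\<close> applies.\<close>

lemma distr_address:
  assumes "nonatomic_invariant_measure X \<mu>"
  shows "distr \<mu> Z2_haar address = Z2_haar"
proof (rule Z2_haar_unique)
  have \<mu>: "sets \<mu> = sets (restrict_space borel X)" and inv: "invariant_prob \<mu> shift"
    using assms by (auto simp: nonatomic_invariant_measure_def)
  interpret prob_space \<mu> using inv by (simp add: invariant_prob_def)
  have sm: "shift \<in> measurable \<mu> \<mu>" and d: "distr \<mu> \<mu> shift = \<mu>"
    using inv by (auto simp: invariant_prob_def)
  have om: "odometer \<in> measurable Z2_haar Z2_haar"
    using invariant_odometer by (simp add: invariant_prob_def)
  note am = address_measurable[OF \<mu>]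
  let ?\<nu> = "distr \<mu> Z2_haar address"
  show "sets ?\<nu> = sets (restrict_space borel Z2)" by (simp add: sets_Z2_haar)
  have "distr ?\<nu> ?\<nu> odometer = distr ?\<nu> Z2_haar odometer" by (rule distr_cong) simp_all
  also have "\<dots> = distr \<mu> Z2_haar (odometer \<circ> address)" by (rule distr_distr[OF om am])
  also have "\<dots> = distr \<mu> Z2_haar (address \<circ> shift)"
  proof (rule distr_cong_AE)
    show "AE x in \<mu>. (odometer \<circ> address) x = (address \<circ> shift) x"
      using AE_zero[OF assms] by (rule AE_mp)
        (intro AE_I2, auto simp: orbit_closure_space[OF \<mu>] address_shift)
  qed (use measurable_comp[OF am om] measurable_comp[OF sm am] in simp_all)
  also have "\<dots> = distr (distr \<mu> \<mu> shift) Z2_haar address" by (rule distr_distr[OF am sm, symmetric])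
  also have "\<dots> = ?\<nu>" by (simp only: d)
  finally show "invariant_prob ?\<nu> odometer"
    using om prob_space_distr[OF am] by (simp add: invariant_prob_def)
qed

text \<open>\<open>coding\<close> inverts \<open>address\<close> almost everywhere. This gives
  uniqueness, since \<open>\<mu>\<close> enters the left-hand side only through its
  sigma-algebra.\<close>

lemma distr_coding:
  assumes "nonatomic_invariant_measure X \<mu>"
  shows "distr Z2_haar \<mu> coding = \<mu>"
proof -
  have \<mu>: "sets \<mu> = sets (restrict_space borel X)"
    using assms by (simp add: nonatomic_invariant_measure_def)
  note am = address_measurable[OF \<mu>] and cm = coding_measurable[OF \<mu>]
  have "distr Z2_haar \<mu> coding = distr (distr \<mu> Z2_haar address) \<mu> coding"
    by (simp only: distr_address[OF assms])
  also have "\<dots> = distr \<mu> \<mu> (coding \<circ> address)" by (rule distr_distr[OF cm am])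
  also have "\<dots> = distr \<mu> \<mu> (\<lambda>x. x)"
  proof (rule distr_cong_AE)
    show "AE x in \<mu>. (coding \<circ> address) x = x"
      using AE_zero[OF assms] by (rule AE_mp)
        (intro AE_I2, auto simp: orbit_closure_space[OF \<mu>] coding_address)
  qed (use measurable_comp[OF am cm] in simp_all)
  also have "\<dots> = \<mu>" by (rule distr_id)
  finally show ?thesis .
qed

text \<open>Existence. Invariance comes from \<open>shift_coding\<close>. For nonatomicity, a set of
  positive mass is cut by the residue of the address at a level so high that each piece has less
  mass than the set; some piece has positive mass.\<close>

lemma nonatomic_invariant_distr_coding:
  "nonatomic_invariant_measure X (distr Z2_haar (restrict_space borel X) coding)"
proof -
  interpret Z: prob_space Z2_haar by (rule prob_space_Z2_haar)
  define \<mu> where "\<mu> = distr Z2_haar (restrict_space borel X) coding"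
  have \<mu>: "sets \<mu> = sets (restrict_space borel X)" by (simp add: \<mu>_def)
  note sp = orbit_closure_space[OF \<mu>]
  have cm': "coding \<in> measurable Z2_haar (restrict_space borel X)" by (rule coding_measurable[OF refl])
  have cm: "coding \<in> measurable Z2_haar \<mu>" by (rule coding_measurable[OF \<mu>])
  have d: "distr Z2_haar \<mu> coding = \<mu>" unfolding \<mu>_def by (rule distr_cong) simp_all
  interpret prob_space \<mu> unfolding \<mu>_def by (rule Z.prob_space_distr[OF cm'])
  have om: "odometer \<in> measurable Z2_haar Z2_haar" and od: "distr Z2_haar Z2_haar odometer = Z2_haar"
    using invariant_odometer by (simp_all add: invariant_prob_def)
  have sm: "shift \<in> measurable \<mu> \<mu>"
  proof (rule measurable_coordinatesI[OF \<mu>])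
    show "(\<lambda>x. shift x k) \<in> measurable \<mu> (count_space UNIV)" for k
      unfolding shift_def by (rule coordinate_measurable[OF \<mu>])
  qed (simp add: sp shift_in)
  have "distr \<mu> \<mu> shift = distr (distr Z2_haar \<mu> coding) \<mu> shift" by (simp only: d)
  also have "\<dots> = distr Z2_haar \<mu> (shift \<circ> coding)" by (rule distr_distr[OF sm cm])
  also have "\<dots> = distr Z2_haar \<mu> (coding \<circ> odometer)"
    by (rule distr_cong) (simp_all add: space_Z2_haar shift_coding)
  also have "\<dots> = distr (distr Z2_haar Z2_haar odometer) \<mu> coding"
    by (rule distr_distr[OF cm om, symmetric])
  finally have inv: "invariant_prob \<mu> shift"
    unfolding invariant_prob_def using sm prob_space_axioms by (simp add: od d)
  have "nonatomic \<mu>"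
    unfolding nonatomic_def
  proof (intro ballI impI)
    fix A assume A: "A \<in> sets \<mu>" and pos: "0 < emeasure \<mu> A"
    then have "0 < prob A" by (simp add: emeasure_eq_measure)
    then obtain n where n: "(1 / 2) ^ n < prob A"
      using real_arch_pow_inv[of "prob A" "1 / 2"] by auto
    define B where "B a = {x\<in>A. address x n = a}" for a
    have AX: "A \<subseteq> X" using sets.sets_into_space[OF A] sp by simp
    have B: "B a \<in> sets \<mu>" for a
    proof -
      have "(\<lambda>x. address x n) \<in> measurable \<mu> (count_space UNIV)"
        by (rule measurable_compose[OF address_measurable[OF \<mu>] coordinate_measurable_Z2_haar])
      then have "A \<inter> ((\<lambda>x. address x n) -` {a} \<inter> space \<mu>) \<in> sets \<mu>"
        using A by (intro sets.Int measurable_sets) auto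
      also have "A \<inter> ((\<lambda>x. address x n) -` {a} \<inter> space \<mu>) = B a"
        using AX by (auto simp: B_def sp)
      finally show ?thesis .
    qed
    have "A = (\<Union>a<2 ^ n. B a)"
      using AX address_in unfolding B_def Z2_def by auto
    then have "prob A \<le> (\<Sum>a<2 ^ n. prob (B a))"
      using finite_measure_subadditive_finite[of "{..<2 ^ n}" B] B by auto
    then have "\<exists>a<2 ^ n. prob (B a) \<noteq> 0"
      using \<open>0 < prob A\<close> by (metis lessThan_iff linorder_not_less sum.neutral)
    then obtain a where a: "a < 2 ^ n" and Ba: "prob (B a) \<noteq> 0" by blast
    have "prob (B a) = measure (distr Z2_haar \<mu> coding) (B a)" by (simp only: d)
    also have "\<dots> = Z.prob (coding -` B a \<inter> space Z2_haar)" by (rule measure_distr[OF cm B])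
    \<comment> \<open>\<open>address\<close> inverts \<open>coding\<close> where the coding has a
      zero, hence almost everywhere.\<close>
    also have "\<dots> \<le> Z.prob {z\<in>Z2. z n = a}"
    proof (rule Z.finite_measure_mono_AE)
      show "AE z in Z2_haar. z \<in> coding -` B a \<inter> space Z2_haar \<longrightarrow> z \<in> {z\<in>Z2. z n = a}"
        using AE_not_hit by (rule AE_mp)
          (intro AE_I2, auto simp: B_def space_Z2_haar address_coding)
      show "{z\<in>Z2. z n = a} \<in> Z.events"
        using Z2_cylinder_sets[OF sets_Z2_haar, of n "{a}"] by simp
    qed
    also have "\<dots> = (1 / 2) ^ n" by (simp add: measure_Z2_haar_cylinder[OF a] power_one_over)
    finally have "prob (B a) < prob A" using n by linarith
    moreover have "B a \<subseteq> A" by (auto simp: B_def)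
    ultimately show "\<exists>B\<in>sets \<mu>. B \<subseteq> A \<and> 0 < emeasure \<mu> B \<and> emeasure \<mu> B < emeasure \<mu> A"
      using B Ba by (intro bexI[of _ "B a"]) (auto simp: emeasure_eq_measure less_le)
  qed
  then show ?thesis
    using \<mu> inv by (simp add: nonatomic_invariant_measure_def \<mu>_def)
qed

text \<open>The isomorphism is \<open>address\<close> on the points with a zero; its inverse is
  \<open>coding\<close> on the 2-adic integers whose coding has a zero.\<close>

lemma measure_isomorphic_odometer:
  assumes "nonatomic_invariant_measure X \<mu>"
  shows "measure_isomorphic \<mu> shift Z2_haar odometer"
proof -
  have \<mu>: "sets \<mu> = sets (restrict_space borel X)"
    using assms by (simp add: nonatomic_invariant_measure_def)
  note sp = orbit_closure_space[OF \<mu>]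
  note am = address_measurable[OF \<mu>] and cm = coding_measurable[OF \<mu>]
  define A where "A = {x\<in>X. \<exists>k. x k = 0}"
  define B where "B = {z\<in>Z2. \<exists>k. \<not> hit z k}"
  have A: "A \<in> sets \<mu>" unfolding A_def by (rule zero_set_measurable[OF \<mu>])
  have B: "B \<in> sets Z2_haar"
  proof -
    have "{z\<in>space Z2_haar. \<exists>k. \<not> hit z k} \<in> sets Z2_haar" by measurable
    then show ?thesis by (simp add: B_def space_Z2_haar)
  qed
  have A0: "emeasure \<mu> (space \<mu> - A) = 0"
  proof (subst AE_iff_measurable[symmetric, of "space \<mu> - A" \<mu> "\<lambda>x. x \<in> A"])
    show "AE x in \<mu>. x \<in> A"
      using AE_zero[OF assms] by (rule AE_mp) (intro AE_I2, auto simp: A_def sp)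
  qed (use A in auto)
  have B0: "emeasure Z2_haar (space Z2_haar - B) = 0"
  proof (subst AE_iff_measurable[symmetric, of "space Z2_haar - B" Z2_haar "\<lambda>z. z \<in> B"])
    show "AE z in Z2_haar. z \<in> B"
      using AE_not_hit by (rule AE_mp) (intro AE_I2, auto simp: B_def space_Z2_haar)
  qed (use B in auto)
  have fA: "address x \<in> B" "coding (address x) = x" if x: "x \<in> A" for x
  proof -
    obtain k where k: "x \<in> X" "x k = 0" using x by (auto simp: A_def)
    show c: "coding (address x) = x" by (rule coding_address[OF k])
    have "\<not> hit (address x) k" using k c coding_eq_0_iff by metis
    then show "address x \<in> B" using address_in[OF k(1)] by (auto simp: B_def)
  qed
  have fB: "coding z \<in> A" "address (coding z) = z" if z: "z \<in> B" for z
    using z coding_in_orbit_closure address_coding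
    by (auto simp: A_def B_def coding_eq_0_iff)
  have bij: "bij_betw address A B"
    by (rule bij_betwI'[where f = address]) (use fA fB in metis)+
  have inv: "the_inv_into A address z = coding z" if "z \<in> B" for z
    by (rule the_inv_into_f_eq) (use bij fB[OF that] in \<open>auto simp: bij_betw_def\<close>)
  have spA: "space (restrict_space \<mu> A) = A" and spB: "space (restrict_space Z2_haar B) = B"
    by (auto simp: space_restrict_space sp space_Z2_haar A_def B_def)
  have m1: "address \<in> measurable (restrict_space \<mu> A) (restrict_space Z2_haar B)"
    by (intro measurable_restrict_space2 measurable_restrict_space1 am) (auto simp: spA fA)
  have "coding \<in> measurable (restrict_space Z2_haar B) (restrict_space \<mu> A)"
    by (intro measurable_restrict_space2 measurable_restrict_space1 cm) (auto simp: spB fB)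
  then have m2: "the_inv_into A address \<in> measurable (restrict_space Z2_haar B) (restrict_space \<mu> A)"
    by (subst measurable_cong[where g = coding]) (auto simp: spB inv)
  have d: "distr (restrict_space \<mu> A) (restrict_space Z2_haar B) address = restrict_space Z2_haar B"
  proof (rule measure_eqI)
    fix E assume "E \<in> sets (distr (restrict_space \<mu> A) (restrict_space Z2_haar B) address)"
    then have E: "E \<in> sets (restrict_space Z2_haar B)" by simp
    then have EB: "E \<subseteq> B" and E': "E \<in> sets Z2_haar"
      using B by (auto simp: sets_restrict_space)
    have AX: "A \<inter> space \<mu> \<in> sets \<mu>" "B \<inter> space Z2_haar \<in> sets Z2_haar"
      using A B by auto
    have "emeasure (distr (restrict_space \<mu> A) (restrict_space Z2_haar B) address) E =
        emeasure (restrict_space \<mu> A) (address -` E \<inter> A)"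
      by (simp add: emeasure_distr[OF m1 E] spA)
    also have "\<dots> = emeasure \<mu> (address -` E \<inter> A)"
      by (rule emeasure_restrict_space[OF AX(1)]) simp
    also have "\<dots> = emeasure \<mu> (address -` E \<inter> space \<mu>)"
    proof (rule emeasure_eq_AE)
      show "AE x in \<mu>. x \<in> address -` E \<inter> A \<longleftrightarrow> x \<in> address -` E \<inter> space \<mu>"
        using AE_zero[OF assms] by (rule AE_mp) (intro AE_I2, auto simp: A_def sp)
      show "address -` E \<inter> space \<mu> \<in> sets \<mu>" by (rule measurable_sets[OF am E'])
      then have "(address -` E \<inter> space \<mu>) \<inter> A \<in> sets \<mu>" using A by (rule sets.Int)
      also have "(address -` E \<inter> space \<mu>) \<inter> A = address -` E \<inter> A"
        by (auto simp: A_def sp)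
      finally show "address -` E \<inter> A \<in> sets \<mu>" .
    qed
    also have "\<dots> = emeasure (distr \<mu> Z2_haar address) E"
      by (rule emeasure_distr[OF am E', symmetric])
    also have "\<dots> = emeasure (restrict_space Z2_haar B) E"
      unfolding distr_address[OF assms] by (rule emeasure_restrict_space[OF AX(2) EB, symmetric])
    finally show "emeasure (distr (restrict_space \<mu> A) (restrict_space Z2_haar B) address) E =
        emeasure (restrict_space Z2_haar B) E" .
  qed simp
  have sh: "shift x k = x (k + 1)" for x k by (simp add: shift_def)
  \<comment> \<open>Indices range over all integers, so moving by one preserves the existence of a
    zero in both directions.\<close>
  have shiftA: "shift -` A \<inter> space \<mu> = A"
  proof -
    have "(\<exists>k. x (k + 1) = 0) \<longleftrightarrow> (\<exists>k. x k = 0)" for x :: "int \<Rightarrow> nat"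
      by (metis diff_add_cancel)
    then show ?thesis by (auto simp: A_def sp sh shift_in)
  qed
  have odoB: "odometer -` B \<inter> space Z2_haar = B"
  proof -
    have "hit (odometer z) k \<longleftrightarrow> hit z (k + 1)" if "z \<in> Z2" for z k
      using shift_coding[OF that, THEN fun_cong, of k] coding_eq_0_iff sh by metis
    moreover have "(\<exists>k. \<not> hit z (k + 1)) \<longleftrightarrow> (\<exists>k. \<not> hit z k)" for z
      by (metis diff_add_cancel)
    ultimately show ?thesis by (auto simp: B_def space_Z2_haar odometer_in_Z2)
  qed
  have "\<forall>x\<in>A. address (shift x) = odometer (address x)"
    using address_shift by (auto simp: A_def)
  then show ?thesis
    unfolding measure_isomorphic_def
    using A B A0 B0 shiftA odoB bij m1 m2 d by blast
qed

end

theorem mainTheorem2: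
  fixes u :: "nat \<Rightarrow> nat"
  assumes "\<forall>n. has_initial_block u (rank_block n)"
  shows "(\<exists>!\<mu>. nonatomic_invariant_measure (orbit_closure u) \<mu>) \<and>
    (\<forall>\<mu>. nonatomic_invariant_measure (orbit_closure u) \<mu> \<longrightarrow>
       measure_isomorphic \<mu> shift Z2_haar odometer)"
proof -
  interpret rank_one_subshift u using assms by unfold_locales
  have "\<mu> = distr Z2_haar (restrict_space borel X) coding"
    if "nonatomic_invariant_measure X \<mu>" for \<mu>
  proof -
    have "sets \<mu> = sets (restrict_space borel X)"
      using that by (simp add: nonatomic_invariant_measure_def)
    then have "distr Z2_haar \<mu> coding = distr Z2_haar (restrict_space borel X) coding"
      by (intro distr_cong) simp_all
    then show ?thesis by (simp only: distr_coding[OF that])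
  qed
  then show ?thesis
    using nonatomic_invariant_distr_coding measure_isomorphic_odometer by blast
qed

end
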